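(* Write $\dfrac{(q;q)_\infty^9}{(q^3;q^3)_\infty^9}=\sum_{n\ge0}a_nq^n$. Then for all $n\ge0$: $a_n>0$ if $n\equiv0,2,5,8\pmod9$; $a_n<0$ if $n\equiv1,3,4,7\pmod9$; and $a_n=0$ if $n\equiv 6\pmod 9$.
   Context: For $|q|<1$, $(a;q)_\infty=\prod_{k\ge0}(1-aq^k)$. *)

theory Defs
  imports "HOL-Analysis.Analysis"
begin

definition qpoch_inf :: "complex \<Rightarrow> complex \<Rightarrow> complex" where
  "qpoch_inf a q = (\<Prod>k. 1 - a * q ^ k)"

end

theory Submission
  imports Defs "HOL-Complex_Analysis.Complex_Analysis"
begin

unbundle no vec_syntax

text \<open>
  Write \<open>E\<close> for the Euler product and \<open>E\<^sub>k\<close> for \<open>E\<close> at \<open>q\<^sup>k\<close>. Splitting Jacobi's series for \<open>E\<^sup>3\<close>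
  by the index modulo 3 gives \<open>E\<^sup>3 = P(q\<^sup>3) - 3 q E\<^sub>9\<^sup>3\<close>, where \<open>P\<close> is a weighted pentagonal series.
  Hence \<open>E\<^sup>3 / E\<^sub>3\<^sup>3 = \<alpha>(q\<^sup>3) - 3 q \<beta>(q\<^sup>3)\<close> with \<open>\<alpha> = P / E\<^sup>3\<close> and \<open>\<beta> = E\<^sub>3\<^sup>3 / E\<^sup>3\<close>. In its cube,
  the coefficients at exponents 1 and 2 modulo 3 come from \<open>- 9 \<alpha>\<^sup>2 \<beta>\<close> and \<open>27 \<alpha> \<beta>\<^sup>2\<close>, and those at
  exponents 0 modulo 3 from \<open>\<alpha>\<^sup>3 - 27 q \<beta>\<^sup>3\<close>. Multiplying the trisection of \<open>E\<^sup>3\<close> over the three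
  rotations of \<open>q\<close> by cube roots of unity shows that the latter is again \<open>E\<^sup>3 / E\<^sub>3\<^sup>3\<close>, which has no
  terms with exponent 2 modulo 3. It remains to see that \<open>\<alpha>\<close> and \<open>\<beta>\<close> have positive coefficients;
  for \<open>\<alpha>\<close> this follows from the Lambert series of \<open>P / E\<close>, the logarithmic derivative of the triple
  product. Both Jacobi's series and this Lambert series are derivatives at 1 of finite triple
  products.
\<close>

section \<open>Coefficientwise limits and congruences of formal power series\<close>

lemma tendsto_fps_mult:
  fixes f g :: "'b \<Rightarrow> 'a::comm_ring_1 fps"
  assumes "(f \<longlongrightarrow> F) net" "(g \<longlongrightarrow> G) net"
  shows "((\<lambda>x. f x * g x) \<longlongrightarrow> F * G) net"
proof (rule tendsto_fpsI)
  fix n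
  have "eventually (\<lambda>x. \<forall>i\<in>{..n}. f x $ i = F $ i \<and> g x $ i = G $ i) net"
    using assms unfolding tendsto_fps_iff
    by (subst eventually_ball_finite_distrib) (auto simp: eventually_conj_iff)
  thus "eventually (\<lambda>x. (f x * g x) $ n = (F * G) $ n) net"
    by eventually_elim (auto simp: fps_mult_nth intro!: sum.cong)
qed

lemma tendsto_fps_add:
  fixes f g :: "'b \<Rightarrow> 'a::comm_ring_1 fps"
  assumes "(f \<longlongrightarrow> F) net" "(g \<longlongrightarrow> G) net"
  shows "((\<lambda>x. f x + g x) \<longlongrightarrow> F + G) net"
proof (rule tendsto_fpsI)
  fix n
  have "eventually (\<lambda>x. f x $ n = F $ n) net" "eventually (\<lambda>x. g x $ n = G $ n) net"
    using assms unfolding tendsto_fps_iff by auto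
  thus "eventually (\<lambda>x. (f x + g x) $ n = (F + G) $ n) net"
    by eventually_elim auto
qed

lemma tendsto_fps_power:
  fixes f :: "'b \<Rightarrow> 'a::comm_ring_1 fps"
  assumes "(f \<longlongrightarrow> F) net"
  shows "((\<lambda>x. f x ^ k) \<longlongrightarrow> F ^ k) net"
  by (induction k) (auto intro: tendsto_fps_mult assms)

lemma tendsto_fps_compose:
  fixes f :: "'b \<Rightarrow> 'a::comm_ring_1 fps"
  assumes "(f \<longlongrightarrow> F) net"
  shows "((\<lambda>x. f x oo G) \<longlongrightarrow> F oo G) net"
proof (rule tendsto_fpsI)
  fix n
  have "eventually (\<lambda>x. \<forall>i\<in>{..n}. f x $ i = F $ i) net"
    using assms unfolding tendsto_fps_iff
    by (subst eventually_ball_finite_distrib) auto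
  thus "eventually (\<lambda>x. (f x oo G) $ n = (F oo G) $ n) net"
    by eventually_elim (auto simp: fps_compose_def intro!: sum.cong)
qed

text \<open>Divisibility by \<open>fps_X ^ N\<close> serves below as congruence modulo q^N, so that
  error terms can be handled with the rules for \<open>dvd\<close>.\<close>

lemma fps_X_power_dvd_iff:
  fixes f :: "'a::comm_ring_1 fps"
  shows "fps_X ^ N dvd f \<longleftrightarrow> (\<forall>i<N. f $ i = 0)"
proof
  assume "fps_X ^ N dvd f"
  then obtain g where "f = fps_X ^ N * g" by (auto elim: dvdE)
  thus "\<forall>i<N. f $ i = 0" by (simp add: fps_X_power_mult_nth)
next
  assume *: "\<forall>i<N. f $ i = 0"
  have "f = fps_X ^ N * fps_shift N f"
    by (rule fps_ext) (use * in \<open>auto simp: fps_X_power_mult_nth\<close>)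
  thus "fps_X ^ N dvd f" by (rule dvdI)
qed

section \<open>Infinite products of factors \<open>1 - q\<^sup>k\<close>\<close>

definition eprod :: "nat set \<Rightarrow> 'a::comm_ring_1 fps" where
  "eprod S = Abs_fps (\<lambda>n. (\<Prod>k\<in>S \<inter> {1..n}. 1 - fps_X ^ k) $ n)"

text \<open>Each further factor \<open>1 - fps_X ^ Suc m\<close> changes only coefficients of index
  above m.\<close>

lemma eprod_nth:
  assumes "n \<le> m"
  shows "(\<Prod>k\<in>S \<inter> {1..m}. 1 - fps_X ^ k) $ n = (eprod S :: 'a::comm_ring_1 fps) $ n"
  using assms
proof (induction m rule: dec_induct)
  case base
  thus ?case by (simp add: eprod_def)
next
  case (step m)
  show ?case
  proof (cases "Suc m \<in> S")
    case True
    have "S \<inter> {1..Suc m} = insert (Suc m) (S \<inter> {1..m})"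
      using True by auto
    hence "(\<Prod>k\<in>S \<inter> {1..Suc m}. 1 - fps_X ^ k)
        = (\<Prod>k\<in>S \<inter> {1..m}. 1 - fps_X ^ k) - fps_X ^ Suc m * (\<Prod>k\<in>S \<inter> {1..m}. 1 - fps_X ^ k :: 'a fps)"
      by (simp add: algebra_simps)
    thus ?thesis using step
      by (simp only: fps_sub_nth fps_X_power_mult_nth) simp
  next
    case False
    hence "S \<inter> {1..Suc m} = S \<inter> {1..m}"
      by (auto simp: le_Suc_eq)
    thus ?thesis using step by simp
  qed
qed

lemma eprod_limit:
  "(\<lambda>m. \<Prod>k\<in>S \<inter> {1..m}. 1 - fps_X ^ k :: 'a::comm_ring_1 fps) \<longlonglongrightarrow> eprod S"
  by (rule tendsto_fpsI) (use eprod_nth eventually_ge_at_top in \<open>blast intro: eventually_mono\<close>)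

lemma eprod_nth_0 [simp]: "(eprod S :: 'a::comm_ring_1 fps) $ 0 = 1"
  by (simp add: eprod_def)

lemma eprod_nonzero [simp]: "(eprod S :: 'a::comm_ring_1 fps) \<noteq> 0"
  by (metis eprod_nth_0 fps_zero_nth zero_neq_one)

lemma eprod_remove:
  assumes "j \<in> S" "j > 0"
  shows "(eprod S :: 'a::comm_ring_1 fps) = (1 - fps_X ^ j) * eprod (S - {j})"
proof -
  have "(\<lambda>m. (1 - fps_X ^ j) * (\<Prod>k\<in>(S - {j}) \<inter> {1..m}. 1 - fps_X ^ k :: 'a fps))
      \<longlonglongrightarrow> (1 - fps_X ^ j) * eprod (S - {j})"
    by (intro tendsto_fps_mult tendsto_const eprod_limit)
  moreover have "eventually (\<lambda>m. (1 - fps_X ^ j) * (\<Prod>k\<in>(S - {j}) \<inter> {1..m}. 1 - fps_X ^ k :: 'a fps)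
      = (\<Prod>k\<in>S \<inter> {1..m}. 1 - fps_X ^ k)) sequentially"
    using eventually_ge_at_top[of j]
  proof eventually_elim
    case (elim m)
    have "S \<inter> {1..m} = insert j ((S - {j}) \<inter> {1..m})"
      using elim assms by auto
    thus ?case by simp
  qed
  ultimately have "(\<lambda>m. \<Prod>k\<in>S \<inter> {1..m}. 1 - fps_X ^ k :: 'a fps) \<longlonglongrightarrow> (1 - fps_X ^ j) * eprod (S - {j})"
    by (rule Lim_transform_eventually)
  thus ?thesis using eprod_limit LIMSEQ_unique by blast
qed

section \<open>The dilation q -> q^3 and the factors of index prime to 3\<close>

abbreviation euler_fps :: "'a::comm_ring_1 fps" where
  "euler_fps \<equiv> eprod UNIV"

definition dil3 :: "'a::comm_ring_1 fps \<Rightarrow> 'a fps" where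
  "dil3 F = F oo fps_X ^ 3"

lemma dil3_nth: "dil3 F $ n = (if 3 dvd n then F $ (n div 3) else 0)"
  by (simp add: dil3_def fps_nth_compose_X_power)

lemma dil3_hom [simp]:
  fixes F G :: "'a::idom fps"
  shows "dil3 (F * G) = dil3 F * dil3 G" "dil3 (F + G) = dil3 F + dil3 G"
    "dil3 (F - G) = dil3 F - dil3 G" "dil3 (F ^ n) = dil3 F ^ n"
    "dil3 fps_X = fps_X ^ 3" "dil3 1 = 1" "dil3 (numeral k) = numeral k"
  by (simp_all add: dil3_def fps_compose_mult_distrib fps_compose_add_distrib fps_compose_sub_distrib
      flip: fps_compose_power)

lemma dil3_prod: "dil3 (\<Prod>i\<in>A. f i :: 'a::idom fps) = (\<Prod>i\<in>A. dil3 (f i))"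
  by (induction A rule: infinite_finite_induct) auto

lemma dil3_inj: "dil3 F = dil3 G \<Longrightarrow> F = G"
proof (rule fps_ext)
  fix n
  assume "dil3 F = dil3 G"
  hence "dil3 F $ (3 * n) = dil3 G $ (3 * n)" by simp
  thus "F $ n = G $ n" by (simp add: dil3_nth)
qed

abbreviation non3 :: "nat set" where
  "non3 \<equiv> {k. \<not> 3 dvd k}"

lemma non3_split: "{1..3 * m} = (non3 \<inter> {1..3 * m}) \<union> (*) 3 ` {1..m}"
proof -
  have "x \<in> (*) 3 ` {1..m}" if "x \<in> {1..3 * m}" "3 dvd x" for x
  proof -
    from that obtain y where "x = 3 * y" by auto
    thus ?thesis using that by auto
  qed
  thus ?thesis by auto
qed

lemma prod_split3:
  "(\<Prod>k\<in>{1..3 * m}. f k) = (\<Prod>k\<in>non3 \<inter> {1..3 * m}. f k) * (\<Prod>k\<in>{1..m}. f (3 * k))"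
  for f :: "nat \<Rightarrow> 'a::comm_monoid_mult"
proof -
  have "(\<Prod>k\<in>{1..3 * m}. f k) = (\<Prod>k\<in>non3 \<inter> {1..3 * m}. f k) * (\<Prod>k\<in>(*) 3 ` {1..m}. f k)"
    by (subst non3_split, subst prod.union_disjoint) auto
  also have "(\<Prod>k\<in>(*) 3 ` {1..m}. f k) = (\<Prod>k\<in>{1..m}. f (3 * k))"
    by (subst prod.reindex) (auto simp: inj_on_def)
  finally show ?thesis .
qed

lemma filterlim_times3: "filterlim (\<lambda>m::nat. 3 * m) sequentially sequentially"
  by (rule filterlim_subseq) (auto simp: strict_mono_def)

text \<open>Sort the first 3m factors by divisibility of the index by 3 and let m grow. Thus
  \<open>eprod non3\<close> plays the part of E/E_3.\<close>

lemma euler_fps_split: "(euler_fps :: 'a::idom fps) = eprod non3 * dil3 euler_fps"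
proof -
  have "(\<lambda>m. (\<Prod>k\<in>non3 \<inter> {1..3 * m}. 1 - fps_X ^ k) * dil3 (\<Prod>k\<in>UNIV \<inter> {1..m}. 1 - fps_X ^ k :: 'a fps))
      \<longlonglongrightarrow> eprod non3 * dil3 euler_fps"
    unfolding dil3_def
    by (intro tendsto_fps_mult tendsto_fps_compose filterlim_compose[OF eprod_limit filterlim_times3]
        eprod_limit)
  also have "(\<lambda>m. (\<Prod>k\<in>non3 \<inter> {1..3 * m}. 1 - fps_X ^ k) * dil3 (\<Prod>k\<in>UNIV \<inter> {1..m}. 1 - fps_X ^ k :: 'a fps))
      = (\<lambda>m. \<Prod>k\<in>UNIV \<inter> {1..3 * m}. 1 - fps_X ^ k)"
    by (rule ext) (simp only: dil3_prod dil3_hom prod_split3 Int_UNIV_left power_mult)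
  finally show ?thesis
    using LIMSEQ_unique filterlim_compose[OF eprod_limit filterlim_times3] by blast
qed

section \<open>The finite Jacobi triple product\<close>

text \<open>Gaussian binomials through the q-Pascal rule: free of division, hence available for
  power series and for polynomials over them.\<close>

fun qbinom :: "'a::comm_ring_1 \<Rightarrow> nat \<Rightarrow> nat \<Rightarrow> 'a" where
  "qbinom q n 0 = 1"
| "qbinom q 0 (Suc k) = 0"
| "qbinom q (Suc n) (Suc k) = qbinom q n k + q ^ Suc k * qbinom q n (Suc k)"

lemma qbinom_eq_0: "n < k \<Longrightarrow> qbinom q n k = 0"
  by (induction q n k rule: qbinom.induct) auto

lemma qbinom_fact:
  fixes q :: "'a::comm_ring_1"
  assumes "k \<le> n"
  shows "qbinom q n k * ((\<Prod>i\<in>{1..k}. 1 - q ^ i) * (\<Prod>i\<in>{1..n-k}. 1 - q ^ i)) = (\<Prod>i\<in>{1..n}. 1 - q ^ i)"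
  using assms
proof (induction q n k rule: qbinom.induct)
  case (3 q n k)
  define p where "p = (\<lambda>k. \<Prod>i\<in>{1..k}. 1 - q ^ i)"
  have pS: "p (Suc j) = (1 - q ^ Suc j) * p j" for j
    by (simp add: p_def prod.nat_ivl_Suc')
  have IH1: "qbinom q n k * (p k * p (n - k)) = p n"
    using 3 by (simp add: p_def)
  \<comment> \<open>At k = n the induction hypothesis is out of range, but both sides vanish: the
    binomial is 0 and so is \<open>1 - q ^ 0\<close>.\<close>
  have *: "qbinom q n (Suc k) * (p (Suc k) * p (n - k)) = (1 - q ^ (n - k)) * p n"
  proof (cases "k = n")
    case True
    thus ?thesis by (simp add: qbinom_eq_0)
  next
    case False
    hence "n - k = Suc (n - Suc k)" and "Suc k \<le> n" using 3 by auto
    hence "qbinom q n (Suc k) * (p (Suc k) * p (n - k))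
        = (1 - q ^ (n - k)) * (qbinom q n (Suc k) * (p (Suc k) * p (n - Suc k)))"
      using pS[of "n - Suc k"] by (simp add: mult_ac)
    also have "qbinom q n (Suc k) * (p (Suc k) * p (n - Suc k)) = p n"
      using 3(2) \<open>Suc k \<le> n\<close> by (simp add: p_def)
    finally show ?thesis .
  qed
  have "qbinom q (Suc n) (Suc k) * (p (Suc k) * p (Suc n - Suc k))
      = (1 - q ^ Suc k) * (qbinom q n k * (p k * p (n - k)))
        + q ^ Suc k * (qbinom q n (Suc k) * (p (Suc k) * p (n - k)))"
    by (simp add: pS algebra_simps)
  \<comment> \<open>The two Pascal terms combine because (1 - q^(k+1)) + q^(k+1) (1 - q^(n-k))
    telescopes to 1 - q^(n+1).\<close>
  also have "\<dots> = ((1 - q ^ Suc k) + q ^ Suc k * (1 - q ^ (n - k))) * p n"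
    unfolding IH1 * by (simp add: algebra_simps)
  also have "\<dots> = (1 - q ^ (Suc k + (n - k))) * p n"
    by (simp add: power_add algebra_simps)
  also have "Suc k + (n - k) = Suc n" using 3 by simp
  finally show ?case by (simp only: p_def pS[unfolded p_def])
qed (simp_all)

text \<open>The recursion uses ring operations only. This serves for the dilation q -> q^3 and for
  constant polynomials.\<close>

lemma qbinom_hom:
  fixes h :: "'a::comm_ring_1 \<Rightarrow> 'b::comm_ring_1"
  assumes "h 0 = 0" "h 1 = 1" "\<And>x y. h (x + y) = h x + h y" "\<And>x y. h (x * y) = h x * h y"
  shows "h (qbinom q n k) = qbinom (h q) n k"
proof -
  have "h (q ^ n) = h q ^ n" for n q
    by (induction n) (auto simp: assms)
  thus ?thesis
    by (induction q n k rule: qbinom.induct) (auto simp: assms)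
qed

text \<open>Gauss's q-binomial theorem, homogeneous in a and b so that b may later be a power of q.
  The induction splits off the factor i = 0, which replaces a by a*q in the rest, and recombines the
  terms by the q-Pascal rule.\<close>

lemma q_binomial:
  fixes a b q :: "'a::comm_ring_1"
  shows "(\<Prod>i<n. b - a * q ^ i)
       = (\<Sum>k\<le>n. (-1) ^ k * q ^ (k choose 2) * qbinom q n k * a ^ k * b ^ (n - k))"
proof (induction n arbitrary: a)
  case (Suc n)
  define u where "u = (\<lambda>n a k. (-1) ^ k * q ^ (k choose 2) * qbinom q n k * a ^ k * b ^ (n - k))"
  have shift: "Suc k choose 2 = k + (k choose 2)" for k
    by (simp add: numeral_2_eq_2)
  have choose0: "0 choose 2 = 0" by (simp add: binomial_eq_0)
  have "(\<Prod>i<Suc n. b - a * q ^ i) = (b - a) * (\<Prod>i<n. b - (a * q) * q ^ i)"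
    by (simp only: prod.lessThan_Suc_shift) (simp add: mult_ac)
  also have "\<dots> = b * (\<Sum>k\<le>n. u n (a * q) k) - a * (\<Sum>k\<le>n. u n (a * q) k)"
    unfolding Suc.IH u_def by (rule left_diff_distrib)
  also have "(\<Sum>k\<le>n. u n (a * q) k) = u n (a * q) 0 + (\<Sum>k<n. u n (a * q) (Suc k))"
    by (simp add: sum.atMost_shift)
  also have "b * \<dots> = b ^ Suc n + (\<Sum>k<n. b * u n (a * q) (Suc k))"
    by (simp add: u_def sum_distrib_left algebra_simps choose0)
  also have "(\<Sum>k<n. b * u n (a * q) (Suc k))
      = (\<Sum>k\<le>n. (-1) ^ Suc k * q ^ (Suc k choose 2) * (q ^ Suc k * qbinom q n (Suc k)) * a ^ Suc k * b ^ (n - k))"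
  proof -
    have "(\<Sum>k<n. b * u n (a * q) (Suc k))
      = (\<Sum>k<n. (-1) ^ Suc k * q ^ (Suc k choose 2) * (q ^ Suc k * qbinom q n (Suc k)) * a ^ Suc k * b ^ (n - k))"
    proof (rule sum.cong)
      fix k assume "k \<in> {..<n}"
      hence "n - k = Suc (n - Suc k)" by auto
      thus "b * u n (a * q) (Suc k) = (-1) ^ Suc k * q ^ (Suc k choose 2) * (q ^ Suc k * qbinom q n (Suc k)) * a ^ Suc k * b ^ (n - k)"
        by (simp add: u_def power_mult_distrib mult_ac)
    qed simp
    \<comment> \<open>The added term k = n is 0, since \<open>qbinom q n (Suc n)\<close>
      vanishes.\<close>
    also have "\<dots> = (\<Sum>k\<le>n. (-1) ^ Suc k * q ^ (Suc k choose 2) * (q ^ Suc k * qbinom q n (Suc k)) * a ^ Suc k * b ^ (n - k))"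
      by (simp add: qbinom_eq_0 flip: lessThan_Suc_atMost)
    finally show ?thesis .
  qed
  also have "u n (a * q) 0 + (\<Sum>k<n. u n (a * q) (Suc k)) = (\<Sum>k\<le>n. u n (a * q) k)"
    by (simp add: sum.atMost_shift)
  also have "b ^ Suc n + (\<Sum>k\<le>n. (-1) ^ Suc k * q ^ (Suc k choose 2) * (q ^ Suc k * qbinom q n (Suc k)) * a ^ Suc k * b ^ (n - k))
        - a * (\<Sum>k\<le>n. u n (a * q) k)
      = b ^ Suc n + (\<Sum>k\<le>n. u (Suc n) a (Suc k))"
    unfolding u_def shift
    by (simp add: sum_distrib_left power_add power_mult_distrib algebra_simps sum_subtractf[symmetric] sum.distrib[symmetric] sum_negf[symmetric])
  also have "\<dots> = (\<Sum>k\<le>Suc n. u (Suc n) a k)"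
    by (subst sum.atMost_Suc_shift) (simp add: u_def choose0)
  finally show ?case by (simp add: u_def)
qed (simp add: binomial_eq_0)

definition tri :: "int \<Rightarrow> nat" where
  "tri j = nat (j * (j - 1) div 2)"

text \<open>In doubled form, identities between exponents become polynomial identities over the
  integers, without division.\<close>

lemma two_tri: "2 * int (tri j) = j * (j - 1)"
proof -
  have "even (j * (j - 1))" by simp
  moreover have "j * (j - 1) \<ge> 0"
    by (cases "j \<ge> 1") (auto simp: mult_nonpos_nonpos)
  ultimately show ?thesis
    by (simp add: tri_def)
qed

lemma two_choose_two: "2 * int (k choose 2) = int k * (int k - 1)"
proof (induction k)
  case (Suc k)
  have "Suc k choose 2 = k + (k choose 2)" by (simp add: numeral_2_eq_2)
  thus ?case using Suc by (simp add: algebra_simps)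
qed simp

text \<open>The q-binomial theorem with m + m' factors and b = q^m. A power of q comes out of both
  sides and is cancelled at the end.\<close>

lemma finite_triple_product:
  fixes q z :: "'a::idom"
  assumes "q \<noteq> 0"
  shows "(\<Prod>i\<in>{1..m}. q ^ i - z) * (\<Prod>i<m'. 1 - z * q ^ i)
       = (\<Sum>k\<le>m + m'. (-1) ^ k * q ^ tri (int k - int m) * qbinom q (m + m') k * z ^ k)"
    (is "?L = ?R")
proof -
  \<comment> \<open>The first m factors release q^(m choose 2), the other m' release q^m
    each.\<close>
  define e where "e = (m choose 2) + m * m'"
  have 1: "(\<Prod>i<m. q ^ m - z * q ^ i) = q ^ (m choose 2) * (\<Prod>i\<in>{1..m}. q ^ i - z)"
  proof -
    have "(\<Prod>i<m. q ^ m - z * q ^ i) = (\<Prod>i<m. q ^ i * (q ^ (m - i) - z))"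
      by (intro prod.cong) (auto simp: algebra_simps simp flip: power_add)
    also have "\<dots> = q ^ (\<Sum>i<m. i) * (\<Prod>i<m. q ^ (m - i) - z)"
      by (simp add: prod.distrib power_sum)
    also have "(\<Sum>i<m. i) = m choose 2"
      by (induction m) (auto simp: numeral_2_eq_2)
    also have "(\<Prod>i<m. q ^ (m - i) - z) = (\<Prod>i\<in>{1..m}. q ^ i - z)"
      by (rule prod.reindex_bij_witness[of _ "\<lambda>i. m - i" "\<lambda>i. m - i"]) auto
    finally show ?thesis .
  qed
  have 2: "(\<Prod>i<m'. q ^ m - z * q ^ (m + i)) = q ^ (m * m') * (\<Prod>i<m'. 1 - z * q ^ i)"
  proof -
    have "(\<Prod>i<m'. q ^ m - z * q ^ (m + i)) = (\<Prod>i<m'. q ^ m * (1 - z * q ^ i))"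
      by (intro prod.cong) (auto simp: algebra_simps power_add)
    thus ?thesis by (simp add: prod.distrib power_mult)
  qed
  \<comment> \<open>Shifting by \<open>q ^ m\<close> avoids negative powers of \<open>q\<close> and \<open>z\<close>.\<close>
  have "(\<Prod>i<m + m'. q ^ m - z * q ^ i)
      = (\<Prod>i<m. q ^ m - z * q ^ i) * (\<Prod>i<m'. q ^ m - z * q ^ (m + i))"
    by (induction m') (auto simp: mult_ac)
  hence "q ^ e * ?L = (\<Prod>i<m + m'. q ^ m - z * q ^ i)"
    unfolding 1 2 e_def by (simp add: power_add mult_ac)
  also have "\<dots> = (\<Sum>k\<le>m + m'. (-1) ^ k * q ^ (k choose 2) * qbinom q (m + m') k * z ^ k * (q ^ m) ^ (m + m' - k))"
    by (rule q_binomial)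
  also have "\<dots> = q ^ e * ?R"
    unfolding sum_distrib_left
  proof (rule sum.cong)
    fix k assume k: "k \<in> {..m + m'}"
    have "2 * int ((k choose 2) + m * (m + m' - k)) = 2 * int (e + tri (int k - int m))"
    proof -
      have "int (m + m' - k) = int m + int m' - int k" using k by simp
      thus ?thesis
        unfolding e_def of_nat_add of_nat_mult distrib_left two_choose_two two_tri
        by (simp add: algebra_simps)
    qed
    hence "(k choose 2) + m * (m + m' - k) = e + tri (int k - int m)"
      by (simp only: mult_cancel_left of_nat_eq_iff) simp
    hence "q ^ (k choose 2) * (q ^ m) ^ (m + m' - k) = q ^ e * q ^ tri (int k - int m)"
      by (metis power_add power_mult)
    thus "(-1) ^ k * q ^ (k choose 2) * qbinom q (m + m') k * z ^ k * (q ^ m) ^ (m + m' - k)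
        = q ^ e * ((-1) ^ k * q ^ tri (int k - int m) * qbinom q (m + m') k * z ^ k)"
      by (simp add: mult_ac)
  qed simp
  finally show ?thesis using assms by simp
qed

section \<open>Bilateral series and Jacobi's identity\<close>

text \<open>A coefficient over an infinite fibre of \<open>e\<close> is 0; the exponents below have finite fibres.\<close>

definition bil :: "(int \<Rightarrow> 'a::comm_ring_1) \<Rightarrow> (int \<Rightarrow> nat) \<Rightarrow> 'a fps" where
  "bil c e = Abs_fps (\<lambda>n. \<Sum>j | e j = n. c j)"

text \<open>A Tannery-type criterion. Up to order m, indices outside \<open>J m\<close> do not
  contribute, and inside it \<open>G m j\<close> may be replaced by 1, because
  \<open>fps_X ^ e j\<close> pushes the error past order m.\<close>

lemma bil_limit:
  fixes c :: "int \<Rightarrow> 'a::comm_ring_1"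
  assumes J: "\<And>m. finite (J m)" "\<And>m j. j \<notin> J m \<Longrightarrow> m < e j"
    and G: "\<And>m j. j \<in> J m \<Longrightarrow> fps_X ^ N m j dvd G m j - 1"
      "\<And>m j. j \<in> J m \<Longrightarrow> m < e j + N m j"
  shows "(\<lambda>m. \<Sum>j\<in>J m. fps_const (c j) * fps_X ^ e j * G m j) \<longlonglongrightarrow> bil c e"
proof (rule tendsto_fpsI)
  fix n
  show "eventually (\<lambda>m. (\<Sum>j\<in>J m. fps_const (c j) * fps_X ^ e j * G m j) $ n = bil c e $ n) sequentially"
    using eventually_ge_at_top[of n]
  proof eventually_elim
    case (elim m)
    have *: "(fps_const (c j) * fps_X ^ e j * G m j) $ n = (if e j = n then c j else 0)" if j: "j \<in> J m" for j
    proof -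
      have "(G m j - 1) $ i = 0" if "i < N m j" for i
        using G(1)[OF j] that unfolding fps_X_power_dvd_iff by blast
      hence "G m j $ i = (if i = 0 then 1 else 0)" if "i < N m j" for i
        using that by fastforce
      moreover have "n < e j + N m j" using G(2)[OF j] elim by simp
      ultimately have "e j \<le> n \<Longrightarrow> G m j $ (n - e j) = (if n - e j = 0 then 1 else 0)"
        by simp
      thus ?thesis
        by (auto simp: mult.assoc fps_X_power_mult_nth)
    qed
    have "(\<Sum>j\<in>J m. fps_const (c j) * fps_X ^ e j * G m j) $ n = (\<Sum>j\<in>J m. if e j = n then c j else 0)"
      by (simp add: fps_sum_nth *)
    also have "\<dots> = (\<Sum>j\<in>{j\<in>J m. e j = n}. c j)"
      by (rule sum.inter_filter[symmetric]) (rule J)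
    also have "{j\<in>J m. e j = n} = {j. e j = n}"
      using J(2) elim by fastforce
    finally show ?case by (simp add: bil_def)
  qed
qed

text \<open>The binomial is p n / (p k * p (n - k)) for partial products p of E, and all three agree
  with E up to order min k (n - k); so it approximates 1/E.\<close>

lemma qbinom_euler:
  assumes "k \<le> n"
  shows "fps_X ^ Suc (min k (n - k)) dvd qbinom fps_X n k * euler_fps - (1 :: 'a::field fps)"
proof -
  define N where "N = Suc (min k (n - k))"
  define p where "p = (\<lambda>k. \<Prod>i\<in>{1..k}. 1 - fps_X ^ i :: 'a fps)"
  define E where "E = (euler_fps :: 'a fps)"
  have p: "fps_X ^ N dvd p j - E" if "j \<ge> min k (n - k)" for j
  proof -
    have "p j $ i = E $ i" if "i < N" for i
      using eprod_nth[of i j UNIV] that \<open>j \<ge> _\<close> unfolding p_def E_def N_def by simp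
    thus ?thesis by (simp add: fps_X_power_dvd_iff)
  qed
  define b where "b = (qbinom fps_X n k :: 'a fps)"
  have "b * (p k * p (n - k)) = p n"
    unfolding b_def p_def by (rule qbinom_fact) fact
  \<comment> \<open>The right side telescopes, using b * p k * p (n - k) = p n, and shows each
    factor only through its deviation from E.\<close>
  hence "E * (b * E - 1) = (p n - E) - b * p k * (p (n - k) - E) - b * E * (p k - E)"
    by (simp add: algebra_simps)
  also have "fps_X ^ N dvd \<dots>"
    by (intro dvd_diff dvd_mult p) (use assms in auto)
  finally have "fps_X ^ N dvd inverse E * (E * (b * E - 1))"
    by (rule dvd_mult)
  also have "inverse E * (E * (b * E - 1)) = b * E - 1"
    by (simp add: E_def inverse_mult_eq_1 flip: mult.assoc)
  finally show ?thesis by (simp add: N_def b_def E_def)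
qed

lemma dil3_qbinom: "dil3 (qbinom q n k) = qbinom (dil3 q) n k" for q :: "'a::idom fps"
  by (rule qbinom_hom) (simp_all, simp add: dil3_def)

lemma qbinom_euler3:
  assumes "k \<le> n"
  shows "fps_X ^ (3 * Suc (min k (n - k))) dvd qbinom (fps_X ^ 3) n k * dil3 euler_fps - (1 :: 'a::field fps)"
proof -
  obtain h where h: "qbinom fps_X n k * euler_fps - (1 :: 'a fps) = fps_X ^ Suc (min k (n - k)) * h"
    using qbinom_euler[OF assms] by (auto elim: dvdE)
  from arg_cong[OF h, of dil3] show ?thesis
    by (simp only: dil3_hom dil3_qbinom power_mult dvd_triv_left)
qed

text \<open>The triple product in the polynomial ring, with q constant and z equal to c times the
  indeterminate, so that it can be differentiated formally and evaluated at 1.\<close>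

lemma finite_triple_product_poly:
  fixes q c :: "'a::idom"
  assumes "q \<noteq> 0"
  shows "(\<Prod>i\<in>{1..m}. [:q ^ i, - c:]) * (\<Prod>i<m'. [:1, - (c * q ^ i):])
     = (\<Sum>k\<le>m + m'. monom ((-1) ^ k * q ^ tri (int k - int m) * qbinom q (m + m') k * c ^ k) k)"
proof -
  have pow: "[:q:] ^ i = [:q ^ i:]" for i and q :: 'a
    by (induction i) (auto simp: one_pCons)
  have qb: "qbinom [:q:] n k = [:qbinom q n k:]" for n k
    by (rule qbinom_hom[symmetric]) (auto simp: one_pCons)
  have "[:0, c:] ^ k = monom (c ^ k) k" for k
    using monom_power[of c 1 k] by (simp add: monom_Suc monom_0)
  moreover have "(-1) ^ k = [:(-1 :: 'a) ^ k:]" for k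
    using pow[of "-1" k] by (simp add: one_pCons)
  ultimately show ?thesis
    using finite_triple_product[where q = "[:q:]" and z = "[:0, c:]" and m = m and m' = m'] assms
    by (simp add: pow qb smult_monom mult_ac one_pCons)
qed

section \<open>Jacobi's series for the cube of the Euler product\<close>

definition sg :: "int \<Rightarrow> 'a::comm_ring_1" where
  "sg j = (if even j then 1 else -1)"

lemma sg_shift: "(-1) ^ k = (-1) ^ m * (sg (int k - int m) :: 'a::comm_ring_1)"
  by (cases "even k"; cases "even m") (auto simp: sg_def)

lemma sum_shift_int:
  "(\<Sum>k\<le>n. f (int k - int m)) = (\<Sum>j\<in>{- int m..int n - int m}. f j)"
  by (rule sum.reindex_bij_witness[of _ "\<lambda>j. nat (j + int m)" "\<lambda>k. int k - int m"]) auto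

lemma pderiv_sum_monom: "pderiv (\<Sum>k\<in>A. monom (a k) k) = (\<Sum>k\<in>A. monom (of_nat k * a k) (k - 1))"
  by (induction A rule: infinite_finite_induct) (auto simp: pderiv_add pderiv_monom)

text \<open>The triple product with m and m + 1 factors contains 1 - z. At z = 1 it therefore
  vanishes, and its derivative there is minus the product R of the remaining factors, whose value is
  the square up to sign.\<close>

lemma jacobi_finite:
  fixes q :: "'a::idom"
  assumes "q \<noteq> 0"
  shows "(\<Prod>i\<in>{1..m}. 1 - q ^ i) ^ 2
       = (\<Sum>j\<in>{- int m..int m + 1}. - (of_int j * sg j) * q ^ tri j * qbinom q (2 * m + 1) (nat (j + int m)))"
proof -
  define p where "p = (\<Prod>i\<in>{1..m}. 1 - q ^ i)"
  define t where "t = (\<lambda>j. - (of_int j * sg j) * q ^ tri j * qbinom q (2 * m + 1) (nat (j + int m)))"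
  define a where "a = (\<lambda>k. (-1) ^ k * q ^ tri (int k - int m) * qbinom q (2 * m + 1) k)"
  define R where "R = (\<Prod>i\<in>{1..m}. [:q ^ i, - 1:]) * (\<Prod>i<m. [:1, - (q ^ Suc i):])"
  have R1: "poly R 1 = (-1) ^ m * p\<^sup>2"
  proof -
    have "(\<Prod>i\<in>{1..m}. q ^ i - 1) = (-1) ^ m * p"
      unfolding p_def by (induction m) (auto simp: prod.nat_ivl_Suc' algebra_simps)
    moreover have "(\<Prod>i<m. 1 - q ^ Suc i) = p"
      unfolding p_def by (rule prod.reindex_bij_witness[of _ "\<lambda>i. i - 1" Suc]) auto
    ultimately show ?thesis
      by (simp add: R_def poly_prod power2_eq_square)
  qed
  have eq: "[:1, -1:] * R = (\<Sum>k\<le>2 * m + 1. monom (a k) k)"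
  proof -
    have "(\<Prod>i<Suc m. [:1, - (1 * q ^ i):]) = [:1, -1:] * (\<Prod>i<m. [:1, - (q ^ Suc i):])"
      by (subst prod.lessThan_Suc_shift) simp
    hence "[:1, -1:] * R = (\<Prod>i\<in>{1..m}. [:q ^ i, - 1:]) * (\<Prod>i<Suc m. [:1, - (1 * q ^ i):])"
      unfolding R_def by (simp only: mult_ac)
    also have "\<dots> = (\<Sum>k\<le>2 * m + 1. monom (a k) k)"
    proof -
      have "m + Suc m = 2 * m + 1" by simp
      thus ?thesis
        unfolding a_def finite_triple_product_poly[OF assms] by (simp only: power_one mult_1_right)
    qed
    finally show ?thesis .
  qed
  have 0: "(\<Sum>k\<le>2 * m + 1. a k) = 0"
    using arg_cong[OF eq, of "\<lambda>f. poly f 1"]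
    by (simp add: poly_sum poly_monom del: sum.atMost_Suc)
  have "(\<Sum>k\<le>2 * m + 1. of_nat k * a k) = - ((-1) ^ m * p\<^sup>2)"
    using arg_cong[OF eq, of "\<lambda>f. poly (pderiv f) 1"]
    by (simp add: poly_sum poly_monom pderiv_sum_monom pderiv_add pderiv_minus pderiv_pCons R1 del: sum.atMost_Suc)
  \<comment> \<open>Subtracting m times the vanishing sum recentres the weight k to j = k -
    m.\<close>
  hence "- ((-1) ^ m * p\<^sup>2) = (\<Sum>k\<le>2 * m + 1. of_nat k * a k) - of_nat m * (\<Sum>k\<le>2 * m + 1. a k)"
    unfolding 0 by simp
  also have "\<dots> = (\<Sum>k\<le>2 * m + 1. of_int (int k - int m) * a k)"
    unfolding sum_distrib_left sum_subtractf[symmetric] by (rule sum.cong) (simp_all add: algebra_simps)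
  also have "\<dots> = - ((-1) ^ m * (\<Sum>k\<le>2 * m + 1. t (int k - int m)))"
    unfolding sum_distrib_left sum_negf[symmetric]
    by (intro sum.cong refl, subst a_def, subst sg_shift[of _ m]) (simp add: t_def mult_ac)
  also have "(\<Sum>k\<le>2 * m + 1. t (int k - int m)) = (\<Sum>j\<in>{- int m..int m + 1}. t j)"
    unfolding sum_shift_int by simp
  finally show ?thesis by (simp add: p_def t_def)
qed

lemma fps_const_jacobi: "fps_const (- (of_int j * sg j)) = - (of_int j * sg j :: 'a::comm_ring_1 fps)"
  by (cases "even j") (simp_all add: sg_def flip: fps_of_int)

lemma tri_ge:
  shows "j \<ge> 1 \<Longrightarrow> int (tri j) \<ge> j - 1" "j \<le> 0 \<Longrightarrow> int (tri j) \<ge> - j"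
proof -
  assume "j \<ge> 1"
  hence "2 * (j - 1) \<le> j * (j - 1)"
    using mult_right_mono[of 2 j "j - 1"] by (cases "j = 1") auto
  hence "2 * (j - 1) \<le> 2 * int (tri j)" by (simp only: two_tri)
  thus "int (tri j) \<ge> j - 1" by simp
next
  assume "j \<le> 0"
  hence *: "2 * (- j) \<le> (1 - j) * (- j)"
    using mult_right_mono[of 2 "1 - j" "- j"] by (cases "j = 0") auto
  note *
  also have "(1 - j) * (- j) = j * (j - 1)" by (simp add: algebra_simps)
  finally have "2 * (- j) \<le> 2 * int (tri j)" by (simp only: two_tri)
  thus "int (tri j) \<ge> - j" by simp
qed

text \<open>Multiply \<open>jacobi_finite\<close> by E and let m grow: the left side tends to E^3,
  and each Gaussian binomial times E tends to 1. The linear bounds \<open>tri_ge\<close> control the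
  tails.\<close>

lemma jacobi: "(euler_fps :: 'a::field fps) ^ 3 = bil (\<lambda>j. - (of_int j * sg j)) tri"
proof -
  define E where "E = (euler_fps :: 'a fps)"
  have lim: "(\<lambda>m. (\<Prod>i\<in>UNIV \<inter> {1..m}. 1 - fps_X ^ i) ^ 2 * E) \<longlonglongrightarrow> E ^ 2 * E"
    unfolding E_def by (intro tendsto_fps_mult tendsto_fps_power tendsto_const eprod_limit)
  have "(\<lambda>m. (\<Prod>i\<in>UNIV \<inter> {1..m}. 1 - fps_X ^ i) ^ 2 * E) =
      (\<lambda>m. \<Sum>j\<in>{- int m..int m + 1}. fps_const (- (of_int j * sg j)) * fps_X ^ tri j *
            (qbinom fps_X (2 * m + 1) (nat (j + int m)) * E))"
    unfolding Int_UNIV_left fps_const_jacobi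
    by (rule ext, subst jacobi_finite) (simp_all only: fps_X_neq_zero sum_distrib_right mult.assoc not_False_eq_True)
  also have "\<dots> \<longlonglongrightarrow> bil (\<lambda>j. - (of_int j * sg j)) tri"
  proof (rule bil_limit)
    fix m :: nat and j
    show "fps_X ^ (Suc (min (nat (j + int m)) (2 * m + 1 - nat (j + int m)))) dvd
         qbinom fps_X (2 * m + 1) (nat (j + int m)) * E - 1" if "j \<in> {- int m..int m + 1}"
      unfolding E_def by (rule qbinom_euler) (use that in auto)
    show "m < tri j + (Suc (min (nat (j + int m)) (2 * m + 1 - nat (j + int m))))"
      if "j \<in> {- int m..int m + 1}"
      using that tri_ge[of j] by (cases "j \<ge> 1") auto
    show "m < tri j" if "j \<notin> {- int m..int m + 1}"
      using that tri_ge[of j] by (cases "j \<ge> 1") auto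
  qed simp
  finally have "E ^ 2 * E = bil (\<lambda>j. - (of_int j * sg j)) tri"
    by (rule LIMSEQ_unique[OF lim])
  thus ?thesis by (simp add: E_def power3_eq_cube power2_eq_square)
qed

section \<open>The weighted pentagonal series\<close>

text \<open>The generalised pentagonal number j(3j - 1)/2, in the form in which it arises from the
  triple product with base q^3.\<close>

definition pent :: "int \<Rightarrow> nat" where
  "pent j = nat (3 * int (tri j) + j)"

lemma int_pent: "int (pent j) = 3 * int (tri j) + j"
  using tri_ge[of j] by (cases "j \<ge> 1") (auto simp: pent_def)

definition lam :: "nat \<Rightarrow> 'a::field fps" where
  "lam a = fps_X ^ a * inverse (1 - fps_X ^ a)"

lemma lam_nth_eq_0: "n < a \<Longrightarrow> lam a $ n = 0"
  by (simp add: lam_def fps_X_power_mult_nth)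

text \<open>Terms with i \<ge> n start beyond order n. The series \<open>1 + 6 * lambert3\<close> is
  the cubic theta function a(q) of the Borweins.\<close>

definition lambert3 :: "'a::field fps" where
  "lambert3 = Abs_fps (\<lambda>n. (\<Sum>i<n. lam (3 * i + 1) - lam (3 * i + 2)) $ n)"

lemma lambert3_limit: "(\<lambda>m. \<Sum>i<m. lam (3 * i + 1) - lam (3 * i + 2)) \<longlonglongrightarrow> (lambert3 :: 'a::field fps)"
proof (rule tendsto_fpsI)
  fix n
  have "(\<Sum>i<m. lam (3 * i + 1) - lam (3 * i + 2)) $ n = (lambert3 :: 'a fps) $ n" if "n \<le> m" for m
    using that
  proof (induction m rule: dec_induct)
    case base
    thus ?case by (simp add: lambert3_def)
  next
    case (step m)
    thus ?case by (simp add: lam_nth_eq_0)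
  qed
  thus "eventually (\<lambda>m. (\<Sum>i<m. lam (3 * i + 1) - lam (3 * i + 2)) $ n = (lambert3 :: 'a fps) $ n) sequentially"
    using eventually_ge_at_top by (blast intro: eventually_mono)
qed

lemma prod_non3:
  "(\<Prod>k\<in>non3 \<inter> {1..3 * m}. f k) = (\<Prod>i<m. f (3 * i + 1) * f (3 * i + 2))"
  for f :: "nat \<Rightarrow> 'a::comm_monoid_mult"
proof (induction m)
  case (Suc m)
  have "non3 \<inter> {1..3 * Suc m} = insert (3 * m + 1) (insert (3 * m + 2) (non3 \<inter> {1..3 * m}))"
    (is "?A = ?B")
  proof (rule set_eqI)
    fix x
    show "x \<in> ?A \<longleftrightarrow> x \<in> ?B"
      by (simp, presburger)
  qed
  thus ?case using Suc by (simp add: mult_ac)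
qed simp

lemma smult_sum_right: "smult c (\<Sum>i\<in>A. f i) = (\<Sum>i\<in>A. smult c (f i))"
  by (induction A rule: infinite_finite_induct) (auto simp: smult_add_right)

text \<open>The triple product with base q^3 and z replaced by q z, evaluated at z = 1 together with
  its derivative. The logarithmic derivative there is m - L m, which brings in the Lambert
  sum.\<close>

lemma pentagonal_finite:
  fixes L :: "nat \<Rightarrow> 'a::field fps"
  defines "L \<equiv> (\<lambda>m. \<Sum>i<m. lam (3 * i + 1) - lam (3 * i + 2))"
  shows "(\<Sum>j\<in>{- int m..int m}. sg j * (1 - 6 * of_int j) * fps_X ^ pent j * qbinom (fps_X ^ 3) (2 * m) (nat (j + int m)))
     = (\<Prod>k\<in>non3 \<inter> {1..3 * m}. 1 - fps_X ^ k) * (1 + 6 * L m)"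
proof -
  define X where "X = (fps_X :: 'a fps)"
  define R where "R = (\<lambda>m. \<Prod>k\<in>non3 \<inter> {1..3 * m}. 1 - X ^ k)"
  have RS: "R (Suc m) = R m * ((1 - X ^ (3 * m + 1)) * (1 - X ^ (3 * m + 2)))" for m
    unfolding R_def prod_non3 by simp
  define t where "t = (\<lambda>j. sg j * (1 - 6 * of_int j) * X ^ pent j * qbinom (X ^ 3) (2 * m) (nat (j + int m)))"
  define b where "b = (\<lambda>k. (-1) ^ k * X ^ pent (int k - int m) * qbinom (X ^ 3) (2 * m) k)"
  \<comment> \<open>The triple product after removal of q^m: each of the m factors q^(3i+3) - q z
    equals q (q^(3i+2) - z).\<close>
  define D where "D = (\<lambda>m. \<Prod>i<m. [:X ^ (3 * i + 2), - 1:] * [:1, - (X ^ (3 * i + 1)):])"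
  have DS: "D (Suc m) = D m * ([:X ^ (3 * m + 2), - 1:] * [:1, - (X ^ (3 * m + 1)):])" for m
    by (simp add: D_def)
  have D1: "poly (D m) 1 = (-1) ^ m * R m" for m
  proof (induction m)
    case (Suc m)
    show ?case unfolding DS RS poly_mult Suc by (simp add: algebra_simps)
  qed (simp add: D_def R_def)
  have D2: "poly (pderiv (D m)) 1 = (-1) ^ m * R m * (of_nat m - L m)" for m
  proof (induction m)
    case 0
    thus ?case by (simp add: D_def L_def)
  next
    case (Suc m)
    define u v where "u = X ^ (3 * m + 1)" and "v = X ^ (3 * m + 2)"
    \<comment> \<open>These relations stand in for u/(1 - u) and v/(1 - v), so the product rule
      needs no division.\<close>
    have u: "(1 - u) * lam (3 * m + 1) = u" and v: "(1 - v) * lam (3 * m + 2) = v"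
      unfolding u_def v_def X_def lam_def
      by (subst mult.left_commute, subst inverse_mult_eq_1'; simp)+
    have "poly (pderiv (D (Suc m))) 1
       = poly (D m) 1 * (- (1 - u) + (v - 1) * (- u)) + poly (pderiv (D m)) 1 * ((v - 1) * (1 - u))"
      unfolding DS pderiv_mult u_def v_def by (simp add: pderiv_pCons algebra_simps)
    also have "\<dots> = - ((-1) ^ m * R m) * ((1 - u) * (1 - v) * (of_nat m - L m)
          + (1 - u) * (1 - v) + (1 - u) * v - (1 - v) * u)"
      unfolding D1 Suc by (simp add: algebra_simps)
    also have "(1 - u) * (1 - v) * (of_nat m - L m) + (1 - u) * (1 - v) + (1 - u) * v - (1 - v) * u
       = (1 - u) * (1 - v) * (of_nat m - L m) + (1 - u) * (1 - v) + (1 - u) * ((1 - v) * lam (3 * m + 2)) - (1 - v) * ((1 - u) * lam (3 * m + 1))"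
      by (simp only: u v)
    also have "\<dots> = (1 - u) * (1 - v) * (of_nat (Suc m) - L (Suc m))"
      by (simp add: L_def algebra_simps)
    also have "- ((-1) ^ m * R m) * \<dots> = (-1) ^ Suc m * R (Suc m) * (of_nat (Suc m) - L (Suc m))"
      unfolding RS u_def v_def by simp
    finally show ?case .
  qed
  have eq: "D m = (\<Sum>k\<le>2 * m. monom (b k) k)"
  proof -
    have "smult (X ^ m) (D m) = (\<Prod>i\<in>{1..m}. [:(X ^ 3) ^ i, - X:]) * (\<Prod>i<m. [:1, - (X * (X ^ 3) ^ i):])"
    proof -
      have "(\<Prod>i\<in>{1..m}. [:(X ^ 3) ^ i, - X:]) = (\<Prod>i<m. smult X [:X ^ (3 * i + 2), - 1:])"
      proof -
        have "(X ^ 3) ^ Suc i = X * X ^ (3 * i + 2)" for i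
        proof -
          have "3 * Suc i = Suc (3 * i + 2)" by simp
          thus ?thesis by (metis power_mult power_Suc)
        qed
        thus ?thesis
          by (simp add: prod.atLeast1_atMost_eq del: power_Suc)
      qed
      also have "\<dots> = smult (X ^ m) (\<Prod>i<m. [:X ^ (3 * i + 2), - 1:])"
        unfolding prod_smult by simp
      finally have 1: "(\<Prod>i\<in>{1..m}. [:(X ^ 3) ^ i, - X:]) = smult (X ^ m) (\<Prod>i<m. [:X ^ (3 * i + 2), - 1:])" .
      have 2: "(X ^ 3) ^ i = X ^ (3 * i)" for i
        by (simp add: power_mult)
      show ?thesis
        unfolding 1 D_def prod.distrib unfolding 2 by simp
    qed
    also have "\<dots> = (\<Sum>k\<le>2 * m. smult (X ^ m) (monom (b k) k))"
    proof (subst finite_triple_product_poly)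
      have *: "(X ^ 3) ^ tri (int k - int m) * X ^ k = X ^ m * X ^ pent (int k - int m)" for k
      proof -
        have "int (3 * tri (int k - int m) + k) = int (m + pent (int k - int m))"
          by (simp add: int_pent)
        hence "3 * tri (int k - int m) + k = m + pent (int k - int m)"
          by (simp only: of_nat_eq_iff)
        thus ?thesis by (metis power_add power_mult)
      qed
      have "(-1) ^ k * (X ^ 3) ^ tri (int k - int m) * q * X ^ k = X ^ m * ((-1) ^ k * X ^ pent (int k - int m) * q)" for k q
      proof -
        have "(-1) ^ k * (X ^ 3) ^ tri (int k - int m) * q * X ^ k = (-1) ^ k * q * ((X ^ 3) ^ tri (int k - int m) * X ^ k)"
          by (simp only: mult_ac)
        thus ?thesis unfolding * by (simp only: mult_ac)
      qed
      moreover have "m + m = 2 * m" by simp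
      ultimately show "(\<Sum>k\<le>m + m. monom ((-1) ^ k * (X ^ 3) ^ tri (int k - int m) * qbinom (X ^ 3) (m + m) k * X ^ k) k)
          = (\<Sum>k\<le>2 * m. smult (X ^ m) (monom (b k) k))"
        by (simp only: b_def smult_monom)
    qed (simp add: X_def)
    also have "\<dots> = smult (X ^ m) (\<Sum>k\<le>2 * m. monom (b k) k)"
      by (rule smult_sum_right[symmetric])
    finally show ?thesis
      by (rule smult_cancel[rotated]) (simp add: X_def)
  qed
  have 0: "(\<Sum>k\<le>2 * m. b k) = (-1) ^ m * R m"
    using arg_cong[OF eq, of "\<lambda>f. poly f 1"]
    by (simp add: poly_sum poly_monom D1)
  have 1: "(\<Sum>k\<le>2 * m. of_nat k * b k) = (-1) ^ m * R m * (of_nat m - L m)"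
    using arg_cong[OF eq, of "\<lambda>f. poly (pderiv f) 1"]
    by (simp add: poly_sum poly_monom pderiv_sum_monom D2)
  \<comment> \<open>This combination of value and derivative gives index k the weight 1 + 6m - 6k,
    which is 1 - 6j for j = k - m.\<close>
  have "(-1) ^ m * R m * (1 + 6 * L m) = (1 + 6 * of_nat m) * (\<Sum>k\<le>2 * m. b k) - 6 * (\<Sum>k\<le>2 * m. of_nat k * b k)"
    unfolding 0 1 by (simp add: algebra_simps)
  also have "\<dots> = (\<Sum>k\<le>2 * m. (1 - 6 * of_int (int k - int m)) * b k)"
    unfolding sum_distrib_left sum_subtractf[symmetric] by (rule sum.cong) (simp_all add: algebra_simps)
  also have "\<dots> = (-1) ^ m * (\<Sum>k\<le>2 * m. t (int k - int m))"
    unfolding sum_distrib_left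
    by (intro sum.cong refl, subst b_def, subst sg_shift[of _ m]) (simp add: t_def mult_ac)
  also have "(\<Sum>k\<le>2 * m. t (int k - int m)) = (\<Sum>j\<in>{- int m..int m}. t j)"
    unfolding sum_shift_int by simp
  finally show ?thesis by (simp add: X_def R_def t_def)
qed

lemma pent_coeff_of_int: "sg j * (1 - 6 * of_int j) = (of_int (sg j * (1 - 6 * j)) :: 'a::comm_ring_1)"
  by (simp add: sg_def)

lemma fps_const_pent: "fps_const (sg j * (1 - 6 * of_int j)) = (sg j * (1 - 6 * of_int j) :: 'a::comm_ring_1 fps)"
  by (simp only: pent_coeff_of_int fps_of_int)

definition pent_fps :: "'a::comm_ring_1 fps" where
  "pent_fps = bil (\<lambda>j. sg j * (1 - 6 * of_int j)) pent"

text \<open>The limit of \<open>pentagonal_finite\<close> times E_3: the binomials in base q^3 times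
  E_3 tend to 1, and \<open>eprod non3\<close> times E_3 is E.\<close>

lemma pent_fps_eq: "(pent_fps :: 'a::field fps) = euler_fps * (1 + 6 * lambert3)"
proof -
  define E where "E = dil3 (euler_fps :: 'a fps)"
  have lim: "(\<lambda>m. (\<Prod>k\<in>non3 \<inter> {1..3 * m}. 1 - fps_X ^ k) * (1 + 6 * (\<Sum>i<m. lam (3 * i + 1) - lam (3 * i + 2))) * E)
     \<longlonglongrightarrow> eprod non3 * (1 + 6 * lambert3) * E"
    by (intro tendsto_fps_mult tendsto_fps_add tendsto_const filterlim_compose[OF eprod_limit filterlim_times3] lambert3_limit)
  have "(\<lambda>m. (\<Prod>k\<in>non3 \<inter> {1..3 * m}. 1 - fps_X ^ k) * (1 + 6 * (\<Sum>i<m. lam (3 * i + 1) - lam (3 * i + 2))) * E) =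
      (\<lambda>m. \<Sum>j\<in>{- int m..int m}. fps_const (sg j * (1 - 6 * of_int j)) * fps_X ^ pent j *
            (qbinom (fps_X ^ 3) (2 * m) (nat (j + int m)) * E))"
    unfolding fps_const_pent
    by (rule ext, subst pentagonal_finite[symmetric]) (simp_all only: sum_distrib_right mult.assoc)
  also have "\<dots> \<longlonglongrightarrow> pent_fps"
    unfolding pent_fps_def
  proof (rule bil_limit)
    fix m :: nat and j
    have ge: "int (pent j) \<ge> \<bar>j\<bar>"
      using tri_ge[of j] int_pent[of j] by (cases "j \<ge> 1") auto
    show "fps_X ^ (3 * Suc (min (nat (j + int m)) (2 * m - nat (j + int m)))) dvd
         qbinom (fps_X ^ 3) (2 * m) (nat (j + int m)) * E - 1" if "j \<in> {- int m..int m}"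
      unfolding E_def by (rule qbinom_euler3) (use that in auto)
    show "m < pent j + (3 * Suc (min (nat (j + int m)) (2 * m - nat (j + int m))))"
      if "j \<in> {- int m..int m}"
      using that ge by (cases "j \<ge> 0") auto
    show "m < pent j" if "j \<notin> {- int m..int m}"
      using that ge by (cases "j \<ge> 0") auto
  qed simp
  finally have "eprod non3 * (1 + 6 * lambert3) * E = pent_fps"
    by (rule LIMSEQ_unique[OF lim])
  moreover have "eprod non3 * (1 + 6 * lambert3) * E = euler_fps * (1 + 6 * lambert3)"
    unfolding E_def by (subst (2) euler_fps_split) (simp only: mult_ac)
  ultimately show ?thesis by simp
qed

section \<open>Trisections of Jacobi's series\<close>

text \<open>Sort the indices by residue modulo 3. Finite fibres make each coefficient sum additive
  over the three classes.\<close>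

lemma bil_split3:
  assumes fin: "\<And>n. finite {j. e j = n}"
  shows "bil c e = bil (\<lambda>i. c (3 * i)) (\<lambda>i. e (3 * i)) + bil (\<lambda>i. c (3 * i + 1)) (\<lambda>i. e (3 * i + 1))
     + bil (\<lambda>i. c (3 * i + 2)) (\<lambda>i. e (3 * i + 2))"
proof (rule fps_ext)
  fix n
  have *: "(\<Sum>i | e (3 * i + r) = n. c (3 * i + r)) = (\<Sum>j | e j = n \<and> j mod 3 = r. c j)"
    if "r \<in> {0, 1, 2}" for r
  proof (rule sum.reindex_bij_witness[of _ "\<lambda>j. j div 3" "\<lambda>i. 3 * i + r"])
    fix a assume "a \<in> {i. e (3 * i + r) = n}"
    thus "3 * a + r \<in> {j. e j = n \<and> j mod 3 = r}" using that by auto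
  next
    fix b assume b: "b \<in> {j. e j = n \<and> j mod 3 = r}"
    hence "3 * (b div 3) + r = b" by auto
    thus "3 * (b div 3) + r = b" "b div 3 \<in> {i. e (3 * i + r) = n}" using b by auto
  qed (use that in auto)
  have U: "{j. e j = n} = ({j. e j = n \<and> j mod 3 = 0} \<union> {j. e j = n \<and> j mod 3 = 1}) \<union> {j. e j = n \<and> j mod 3 = 2}"
    by auto
  have "(\<Sum>j | e j = n. c j) = (\<Sum>j | e j = n \<and> j mod 3 = 0. c j) + (\<Sum>j | e j = n \<and> j mod 3 = 1. c j)
      + (\<Sum>j | e j = n \<and> j mod 3 = 2. c j)"
  proof -
    have f: "finite {j. e j = n \<and> j mod 3 = r}" for r
      by (rule finite_subset[OF _ fin[of n]]) auto
    show ?thesis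
      unfolding U
      by (subst sum.union_disjoint, use f in simp, use f in simp, force)
         (subst sum.union_disjoint, use f in simp, use f in simp, force, rule refl)
  qed
  also have "\<dots> = (\<Sum>i | e (3 * i) = n. c (3 * i)) + (\<Sum>i | e (3 * i + 1) = n. c (3 * i + 1))
      + (\<Sum>i | e (3 * i + 2) = n. c (3 * i + 2))"
    using *[of 0] *[of 1] *[of 2] by (simp only: insert_iff add_0_right simp_thms)
  finally show "bil c e $ n = (bil (\<lambda>i. c (3 * i)) (\<lambda>i. e (3 * i)) + bil (\<lambda>i. c (3 * i + 1)) (\<lambda>i. e (3 * i + 1))
     + bil (\<lambda>i. c (3 * i + 2)) (\<lambda>i. e (3 * i + 2))) $ n"
    by (simp only: bil_def fps_add_nth fps_nth_Abs_fps)
qed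

lemma bil_times3: "bil c (\<lambda>i. 3 * e i) = dil3 (bil c e)"
proof (rule fps_ext)
  fix n
  have "{i. 3 * e i = n} = (if 3 dvd n then {i. e i = n div 3} else {})"
    by auto
  thus "bil c (\<lambda>i. 3 * e i) $ n = dil3 (bil c e) $ n"
    by (simp add: bil_def dil3_nth)
qed

lemma bil_Suc: "bil c (\<lambda>i. Suc (e i)) = fps_X * bil c e"
proof (rule fps_ext)
  fix n
  show "bil c (\<lambda>i. Suc (e i)) $ n = (fps_X * bil c e) $ n"
    by (cases n) (simp_all add: bil_def)
qed

lemma bil_reindex:
  assumes "\<And>i. g (f i) = i" "\<And>j. f (g j) = j"
  shows "bil c e = bil (\<lambda>i. c (f i)) (\<lambda>i. e (f i))"
proof (rule fps_ext)
  fix n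
  have "(\<Sum>j | e j = n. c j) = (\<Sum>i | e (f i) = n. c (f i))"
    by (rule sum.reindex_bij_witness[of _ f g]) (auto simp: assms)
  thus "bil c e $ n = bil (\<lambda>i. c (f i)) (\<lambda>i. e (f i)) $ n"
    by (simp add: bil_def)
qed

lemma bil_add: "bil (\<lambda>i. c i + d i) e = bil c e + bil d e"
  by (rule fps_ext) (simp add: bil_def sum.distrib)

lemma bil_scale: "bil (\<lambda>i. k * c i) e = fps_const k * bil c e"
  by (rule fps_ext) (simp add: bil_def sum_distrib_left)

lemma finite_tri: "finite {j. tri j = n}"
proof (rule finite_subset)
  show "{j. tri j = n} \<subseteq> {- int n..int n + 1}"
  proof
    fix j assume "j \<in> {j. tri j = n}"
    thus "j \<in> {- int n..int n + 1}"
      using tri_ge[of j] by (cases "j \<ge> 1") auto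
  qed
qed simp

lemma tri_eqI: "2 * int k = j * (j - 1) \<Longrightarrow> tri j = k"
  using two_tri[of j] by simp

lemma two_pent: "2 * int (pent i) = i * (3 * i - 1)"
proof -
  have "2 * int (pent i) = 3 * (2 * int (tri i)) + 2 * i"
    by (simp add: int_pent)
  also have "\<dots> = i * (3 * i - 1)"
    unfolding two_tri by (simp add: algebra_simps)
  finally show ?thesis .
qed

text \<open>Together with the next two lemmas: indices 0 and 1 modulo 3 give exponents divisible by
  3, indices 2 modulo 3 give exponents 1 modulo 9. Hence Jacobi's series has no exponent 2 modulo
  3.\<close>

lemma tri_3: "tri (3 * i) = 3 * pent i"
proof (rule tri_eqI)
  have "2 * int (3 * pent i) = 3 * (2 * int (pent i))" by simp
  thus "2 * int (3 * pent i) = 3 * i * (3 * i - 1)"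
    unfolding two_pent by (simp add: algebra_simps)
qed

lemma tri_3_plus_1: "tri (3 * i + 1) = 3 * pent (- i)"
proof (rule tri_eqI)
  have "2 * int (3 * pent (- i)) = 3 * (2 * int (pent (- i)))" by simp
  thus "2 * int (3 * pent (- i)) = (3 * i + 1) * (3 * i + 1 - 1)"
    unfolding two_pent by (simp add: algebra_simps)
qed

lemma tri_3_plus_2: "tri (3 * i + 2) = Suc (3 * (3 * tri (i + 1)))"
proof (rule tri_eqI)
  have "2 * int (Suc (3 * (3 * tri (i + 1)))) = 9 * (2 * int (tri (i + 1))) + 2" by simp
  thus "2 * int (Suc (3 * (3 * tri (i + 1)))) = (3 * i + 2) * (3 * i + 2 - 1)"
    unfolding two_tri by (simp add: algebra_simps)
qed

lemma sg_simps [simp]: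
  "sg (3 * i) = sg i" "sg (3 * i + 1) = - sg i" "sg (3 * i + 2) = sg i" "sg (- i) = sg i"
  "sg (i - 1) = - sg i" "sg (1 - i) = - sg i"
  by (auto simp: sg_def)

text \<open>The reflection i -> 1 - i fixes \<open>tri\<close> and flips the sign, so the series is
  its own negative.\<close>

lemma bil_sg_tri: "bil sg tri = (0 :: 'a::field_char_0 fps)"
proof -
  have "tri (1 - i) = tri i" for i
    by (rule tri_eqI, subst two_tri) (simp add: algebra_simps)
  hence "bil sg tri = bil (\<lambda>i. - 1 * (sg i :: 'a)) tri"
    by (subst bil_reindex[of "\<lambda>i. 1 - i" "\<lambda>i. 1 - i"]) simp_all
  also have "\<dots> = - bil sg tri"
    by (subst bil_scale) (simp flip: fps_const_neg)
  finally show ?thesis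
    by (metis add_eq_0_iff mult_2 mult_eq_0_iff zero_neq_numeral)
qed

lemma dil3_uminus: "dil3 (- F) = - dil3 F"
  by (rule fps_ext) (simp add: dil3_nth)

text \<open>Residues 0 and 1 both lead to pentagonal exponents, the latter after i -> -i, and their
  weights add up to 1 - 6i. Residue 2 reproduces Jacobi's series at q^9.\<close>

lemma euler_cube_trisection:
  "(euler_fps :: 'a::field_char_0 fps) ^ 3 = dil3 pent_fps - 3 * fps_X * dil3 (dil3 euler_fps ^ 3)"
proof -
  define c where "c = (\<lambda>j. - (of_int j * sg j) :: 'a)"
  have 1: "bil (\<lambda>i. c (3 * i)) (\<lambda>i. tri (3 * i)) = dil3 (bil (\<lambda>i. - (3 * of_int i * sg i)) pent)"
    unfolding tri_3 bil_times3 by (simp add: c_def mult.assoc)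
  have 2: "bil (\<lambda>i. c (3 * i + 1)) (\<lambda>i. tri (3 * i + 1)) = dil3 (bil (\<lambda>i. (1 - 3 * of_int i) * sg i) pent)"
    unfolding tri_3_plus_1 bil_times3
    by (subst bil_reindex[of uminus uminus]) (simp_all add: c_def)
  have 3: "bil (\<lambda>i. - (3 * of_int i * sg i)) pent + bil (\<lambda>i. (1 - 3 * of_int i) * sg i) pent = (pent_fps :: 'a fps)"
    unfolding pent_fps_def bil_add[symmetric] by (simp add: algebra_simps)
  have 4: "bil (\<lambda>i. c (3 * i + 2)) (\<lambda>i. tri (3 * i + 2)) = - 3 * fps_X * dil3 (dil3 (euler_fps ^ 3))"
  proof -
    have "bil (\<lambda>i. c (3 * i + 2)) (\<lambda>i. tri (3 * i + 2)) = fps_X * dil3 (dil3 (bil (\<lambda>i. c (3 * i + 2)) (\<lambda>i. tri (i + 1))))"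
      unfolding tri_3_plus_2 bil_times3 bil_Suc ..
    also have "bil (\<lambda>i. c (3 * i + 2)) (\<lambda>i. tri (i + 1)) = bil (\<lambda>i. - 3 * c i + - 1 * sg i) tri"
    proof -
      \<comment> \<open>After the shift, the weight is -3 times Jacobi's own weight plus a multiple
        of \<open>sg\<close>, which \<open>bil_sg_tri\<close> kills.\<close>
      have "c (3 * (i - 1) + 2) = - 3 * c i + - 1 * sg i" for i
        unfolding c_def sg_simps by (simp add: algebra_simps)
      thus ?thesis
        by (subst bil_reindex[of "\<lambda>i. i + 1" "\<lambda>i. i - 1"]) simp_all
    qed
    also have "\<dots> = - 3 * bil c tri"
      unfolding bil_add bil_scale bil_sg_tri by (simp add: numeral_fps_const)
    also have "bil c tri = euler_fps ^ 3"
      unfolding c_def by (rule jacobi[symmetric])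
    finally show ?thesis
      by (simp add: dil3_uminus mult_ac)
  qed
  have "euler_fps ^ 3 = bil c tri"
    unfolding c_def by (rule jacobi)
  also have "\<dots> = dil3 pent_fps + - 3 * fps_X * dil3 (dil3 (euler_fps ^ 3))"
    unfolding 3[symmetric] dil3_hom(2) 1[symmetric] 2[symmetric] 4[symmetric]
    by (rule bil_split3[OF finite_tri])
  finally show ?thesis by simp
qed

section \<open>The cubic norm\<close>

definition rot :: "'a::comm_ring_1 \<Rightarrow> 'a fps \<Rightarrow> 'a fps" where
  "rot c F = F oo (fps_const c * fps_X)"

lemma rot_nth: "rot c F $ n = c ^ n * F $ n"
  by (simp add: rot_def)

lemma rot_hom [simp]:
  fixes F G :: "'a::idom fps"
  shows "rot c (F * G) = rot c F * rot c G" "rot c (F - G) = rot c F - rot c G"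
    "rot c (F ^ n) = rot c F ^ n" "rot c fps_X = fps_const c * fps_X" "rot c 1 = 1"
    "rot c (numeral k) = numeral k"
  by (simp_all add: rot_def fps_compose_mult_distrib fps_compose_sub_distrib flip: fps_compose_power)

lemma rot_prod: "rot c (\<Prod>i\<in>A. f i :: 'a::idom fps) = (\<Prod>i\<in>A. rot c (f i))"
  by (induction A rule: infinite_finite_induct) auto

lemma rot_dil3: "c ^ 3 = 1 \<Longrightarrow> rot c (dil3 F) = dil3 F"
  by (rule fps_ext) (auto simp: rot_nth dil3_nth power_mult)

text \<open>Stated over a ring, so that c may be a constant power series. In the expansion the mixed
  terms are multiples of 1 + c + c^2.\<close>

lemma cube_root_factor:
  fixes c x y :: "'a::comm_ring_1"
  assumes "1 + c + c\<^sup>2 = 0"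
  shows "(x - y) * (x - c * y) * (x - c\<^sup>2 * y) = x ^ 3 - y ^ 3"
proof -
  have c: "c\<^sup>2 = - 1 - c"
    using assms by (simp add: eq_neg_iff_add_eq_0 algebra_simps)
  have "c ^ 3 = c * c\<^sup>2" by (simp add: power3_eq_cube power2_eq_square)
  also have "\<dots> = - c - c\<^sup>2" by (subst c) (simp add: algebra_simps power2_eq_square)
  also have "\<dots> = 1" by (simp add: c)
  finally have c3: "c ^ 3 = 1" .
  have "(x - y) * (x - c * y) * (x - c\<^sup>2 * y)
     = x ^ 3 - (1 + c + c\<^sup>2) * x\<^sup>2 * y + c * (1 + c + c\<^sup>2) * x * y\<^sup>2 - c ^ 3 * y ^ 3"
    by (simp add: algebra_simps power2_eq_square power3_eq_cube)
  thus ?thesis using assms c3 by simp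
qed

lemma cube_root_power:
  fixes c :: "'a::comm_ring_1"
  assumes "1 + c + c\<^sup>2 = 0" "\<not> 3 dvd k"
  shows "1 + c ^ k + (c ^ k)\<^sup>2 = 0"
proof -
  \<comment> \<open>At x = 0 and y = 1 or -1 the factorization reduces to c^3 = 1 up to
    sign.\<close>
  have c3: "c ^ 3 = 1"
    using cube_root_factor[OF assms(1), of 0 1] cube_root_factor[OF assms(1), of 0 "-1"]
    by (simp add: power3_eq_cube power2_eq_square mult.assoc)
  have "c ^ k = c ^ (3 * (k div 3) + k mod 3)" by simp
  also have "\<dots> = c ^ (k mod 3)"
    unfolding power_add power_mult c3 by simp
  finally have ck: "c ^ k = c ^ (k mod 3)" .
  have "k mod 3 = 1 \<or> k mod 3 = 2" using assms(2) by presburger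
  moreover have "(c\<^sup>2)\<^sup>2 = c"
    using c3 by (simp add: power2_eq_square power3_eq_cube mult.assoc)
  ultimately show ?thesis
    using assms(1) ck by (auto simp: add_ac)
qed

text \<open>Factor by factor: for k prime to 3, w^k is again a root of 1 + x + x^2, so the three
  rotations of 1 - q^k multiply to 1 - q^(3k).\<close>

lemma rot_norm_non3:
  fixes w :: "'a::idom"
  assumes w: "1 + w + w\<^sup>2 = 0"
  shows "eprod non3 * rot w (eprod non3) * rot (w\<^sup>2) (eprod non3) = dil3 (eprod non3)"
proof -
  define p where "p = (\<lambda>m. \<Prod>k\<in>non3 \<inter> {1..m}. 1 - fps_X ^ k :: 'a fps)"
  have "(\<lambda>m. p m * rot w (p m) * rot (w\<^sup>2) (p m)) \<longlonglongrightarrow> eprod non3 * rot w (eprod non3) * rot (w\<^sup>2) (eprod non3)"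
    unfolding rot_def p_def by (intro tendsto_fps_mult tendsto_fps_compose eprod_limit)
  moreover have "(\<lambda>m. dil3 (p m)) \<longlonglongrightarrow> dil3 (eprod non3)"
    unfolding dil3_def p_def by (intro tendsto_fps_compose eprod_limit)
  moreover have "p m * rot w (p m) * rot (w\<^sup>2) (p m) = dil3 (p m)" for m
    unfolding p_def rot_prod dil3_prod prod.distrib[symmetric]
  proof (rule prod.cong)
    fix k assume "k \<in> non3 \<inter> {1..m}"
    hence k: "1 + w ^ k + (w ^ k)\<^sup>2 = 0"
      using cube_root_power[OF w] by auto
    have "1 + fps_const (w ^ k) + (fps_const (w ^ k))\<^sup>2 = (0 :: 'a fps)"
      using k by (metis fps_const_0_eq_0 fps_const_1_eq_1 fps_const_add fps_const_power)
    from cube_root_factor[OF this, of 1 "fps_X ^ k"]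
    show "(1 - fps_X ^ k) * rot w (1 - fps_X ^ k) * rot (w\<^sup>2) (1 - fps_X ^ k) = dil3 (1 - fps_X ^ k)"
      by (simp add: power_mult_distrib power_mult[symmetric] mult.commute)
  qed simp
  ultimately show ?thesis
    using LIMSEQ_unique by auto
qed

text \<open>The product N of the three rotations of E is computed twice: as a product it satisfies N
  E_9 = E_3^4, and by the trisection E^3 = u - v its cube is u^3 - v^3. Comparing the two and
  undoing q -> q^3 gives the claim.\<close>

lemma cubic_norm_complex:
  "(pent_fps ^ 3 - 27 * fps_X * dil3 euler_fps ^ 9) * dil3 euler_fps ^ 3 = (euler_fps :: complex fps) ^ 12"
proof -
  define w where "w = cis (2 * pi / 3)"
  define E where "E = (euler_fps :: complex fps)"
  define D where "D = (eprod non3 :: complex fps)"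
  define P where "P = (pent_fps :: complex fps)"
  have w: "1 + w + w\<^sup>2 = 0"
    by (simp add: w_def complex_eq_iff cos_120 sin_120 power2_eq_square)
  have w3: "w ^ 3 = 1"
    unfolding w_def Complex.DeMoivre by simp
  have "(w\<^sup>2) ^ 3 = (w ^ 3)\<^sup>2"
    by (simp flip: power_mult)
  hence w6: "(w\<^sup>2) ^ 3 = 1"
    by (simp only: w3 power_one)
  define N where "N = E * rot w E * rot (w\<^sup>2) E"
  have ED: "E = D * dil3 E"
    unfolding E_def D_def by (rule euler_fps_split)
  have "N = (D * rot w D * rot (w\<^sup>2) D) * dil3 E ^ 3"
    unfolding N_def by (subst (1 2 3) ED) (simp add: rot_dil3[OF w3] rot_dil3[OF w6] power3_eq_cube mult_ac)
  also have "D * rot w D * rot (w\<^sup>2) D = dil3 D"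
    unfolding D_def using w by (rule rot_norm_non3)
  \<comment> \<open>The factor E_9 completes \<open>dil3 D\<close> to E_3.\<close>
  finally have "N * dil3 (dil3 E) = dil3 (D * dil3 E) * dil3 E ^ 3"
    by simp
  also have "\<dots> = dil3 (E ^ 4)"
    unfolding ED[symmetric] by (simp flip: power_Suc)
  finally have N: "N * dil3 (dil3 E) = dil3 (E ^ 4)" .
  define u v where "u = dil3 P" and "v = 3 * fps_X * dil3 (dil3 E ^ 3)"
  have E3: "E ^ 3 = u - v"
    unfolding E_def u_def v_def P_def by (rule euler_cube_trisection)
  \<comment> \<open>A rotation by a cube root of unity fixes u, a series in q^3, and multiplies v,
    which is q times such a series, by c.\<close>
  have rE: "rot c E ^ 3 = u - fps_const c * v" if "c ^ 3 = 1" for c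
  proof -
    have "rot c E ^ 3 = rot c (E ^ 3)" by simp
    also have "\<dots> = u - fps_const c * v"
      unfolding E3 by (simp add: u_def v_def rot_dil3 that mult_ac)
    finally show ?thesis .
  qed
  have "1 + fps_const w + (fps_const w)\<^sup>2 = 0"
    using w by (metis fps_const_0_eq_0 fps_const_1_eq_1 fps_const_add fps_const_power)
  from cube_root_factor[OF this, of u v]
  have "N ^ 3 = u ^ 3 - v ^ 3"
    unfolding N_def power_mult_distrib rE[OF w3] rE[OF w6] E3 by simp
  also have "\<dots> = dil3 (P ^ 3 - 27 * fps_X * dil3 E ^ 9)"
    by (simp add: u_def v_def power_mult_distrib flip: power_mult)
  finally have "dil3 ((P ^ 3 - 27 * fps_X * dil3 E ^ 9) * dil3 E ^ 3) = (N * dil3 (dil3 E)) ^ 3"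
    by (simp add: power_mult_distrib)
  also have "\<dots> = dil3 (E ^ 12)"
    unfolding N by (simp flip: power_mult)
  finally show ?thesis
    unfolding P_def E_def by (rule dil3_inj)
qed

section \<open>Descent from complex to real coefficients\<close>

definition cplx :: "real fps \<Rightarrow> complex fps" where
  "cplx F = Abs_fps (\<lambda>n. of_real (F $ n))"

lemma cplx_nth [simp]: "cplx F $ n = of_real (F $ n)"
  by (simp add: cplx_def)

lemma cplx_hom [simp]:
  "cplx (F * G) = cplx F * cplx G" "cplx (F - G) = cplx F - cplx G" "cplx 1 = 1"
  "cplx fps_X = fps_X" "cplx (numeral k) = numeral k"
  by (rule fps_ext; simp add: fps_mult_nth fps_numeral_nth)+

lemma cplx_power [simp]: "cplx (F ^ n) = cplx F ^ n"
  by (induction n) auto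

lemma cplx_prod: "cplx (\<Prod>i\<in>A. f i) = (\<Prod>i\<in>A. cplx (f i))"
  by (induction A rule: infinite_finite_induct) auto

lemma cplx_dil3: "cplx (dil3 F) = dil3 (cplx F)"
  by (rule fps_ext) (simp add: dil3_nth)

lemma cplx_eprod: "cplx (eprod S) = eprod S"
proof (rule fps_ext)
  fix n
  have "cplx (\<Prod>k\<in>S \<inter> {1..n}. 1 - fps_X ^ k) = (\<Prod>k\<in>S \<inter> {1..n}. 1 - fps_X ^ k)"
    by (simp add: cplx_prod)
  hence "cplx (\<Prod>k\<in>S \<inter> {1..n}. 1 - fps_X ^ k) $ n = (\<Prod>k\<in>S \<inter> {1..n}. 1 - fps_X ^ k) $ n"
    by (rule arg_cong)
  thus "cplx (eprod S) $ n = eprod S $ n"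
    by (simp add: eprod_def)
qed

lemma cplx_pent_fps: "cplx pent_fps = pent_fps"
proof (rule fps_ext)
  fix n
  have "complex_of_real (sg j) = sg j" for j by (simp add: sg_def)
  thus "cplx pent_fps $ n = pent_fps $ n"
    by (simp add: pent_fps_def bil_def)
qed

lemma cplx_inj: "cplx F = cplx G \<Longrightarrow> F = G"
  by (simp add: fps_eq_iff)

text \<open>All series involved are images of real ones under the injective map \<open>cplx\<close>;
  the cube root of unity is gone from the final identity.\<close>

lemma cubic_norm:
  "(pent_fps ^ 3 - 27 * fps_X * dil3 euler_fps ^ 9) * dil3 euler_fps ^ 3 = (euler_fps :: real fps) ^ 12"
  by (rule cplx_inj) (simp add: cplx_dil3 cplx_eprod cplx_pent_fps cubic_norm_complex)

section \<open>Positivity\<close>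

definition nonneg_fps :: "real fps \<Rightarrow> bool" where
  "nonneg_fps F \<longleftrightarrow> (\<forall>n. 0 \<le> F $ n)"

definition pos_fps :: "real fps \<Rightarrow> bool" where
  "pos_fps F \<longleftrightarrow> (\<forall>n. 0 < F $ n)"

lemma pos_imp_nonneg_fps: "pos_fps F \<Longrightarrow> nonneg_fps F"
  by (auto simp: pos_fps_def nonneg_fps_def intro: less_imp_le)

lemma nonneg_fps_mult: "nonneg_fps F \<Longrightarrow> nonneg_fps G \<Longrightarrow> nonneg_fps (F * G)"
  by (auto simp: nonneg_fps_def fps_mult_nth intro!: sum_nonneg)

lemma nonneg_fps_add: "nonneg_fps F \<Longrightarrow> nonneg_fps G \<Longrightarrow> nonneg_fps (F + G)"
  by (auto simp: nonneg_fps_def)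

lemma nonneg_fps_sum: "(\<And>i. i \<in> A \<Longrightarrow> nonneg_fps (f i)) \<Longrightarrow> nonneg_fps (\<Sum>i\<in>A. f i)"
  by (auto simp: nonneg_fps_def fps_sum_nth intro!: sum_nonneg)

lemma nonneg_fps_1: "nonneg_fps 1"
  by (auto simp: nonneg_fps_def)

lemma nonneg_fps_numeral: "nonneg_fps (numeral k)"
  by (auto simp: nonneg_fps_def fps_numeral_nth)

lemma nonneg_fps_X_power: "nonneg_fps (fps_X ^ k)"
  by (auto simp: nonneg_fps_def)

lemma nonneg_fps_prod: "(\<And>i. i \<in> A \<Longrightarrow> nonneg_fps (f i)) \<Longrightarrow> nonneg_fps (\<Prod>i\<in>A. f i)"
  by (induction A rule: infinite_finite_induct) (auto intro: nonneg_fps_mult nonneg_fps_1)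

lemma nonneg_fps_limit:
  assumes "f \<longlonglongrightarrow> F" "\<And>m. nonneg_fps (f m)"
  shows "nonneg_fps F"
  unfolding nonneg_fps_def
proof
  fix n
  obtain m where "f m $ n = F $ n"
    using assms(1) eventually_happens'[of sequentially] unfolding tendsto_fps_iff by force
  thus "0 \<le> F $ n" using assms(2)[of m] by (metis nonneg_fps_def)
qed

text \<open>In the Cauchy product the term \<open>F $ n * G $ 0\<close> is positive and the others
  are nonnegative.\<close>

lemma pos_fps_mult:
  assumes "pos_fps F" "nonneg_fps G" "G $ 0 > 0"
  shows "pos_fps (F * G)"
  unfolding pos_fps_def
proof
  fix n
  have "0 < F $ n * G $ (n - n)"
    using assms by (simp add: pos_fps_def)
  also have "\<dots> \<le> (\<Sum>i=0..n. F $ i * G $ (n - i))"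
    using assms by (intro member_le_sum) (auto simp: pos_fps_def nonneg_fps_def less_imp_le)
  finally show "0 < (F * G) $ n"
    by (simp add: fps_mult_nth)
qed

lemma pos_fps_mult': "pos_fps F \<Longrightarrow> pos_fps G \<Longrightarrow> pos_fps (F * G)"
  by (intro pos_fps_mult pos_imp_nonneg_fps) (auto simp: pos_fps_def)

lemma inverse_one_minus_X: "inverse (1 - fps_X) = Abs_fps (\<lambda>n. 1 :: real)"
  by (simp add: fps_inverse_gp'[symmetric])

lemma nonneg_inverse_one_minus_X_power: "k > 0 \<Longrightarrow> nonneg_fps (inverse (1 - fps_X ^ k))"
proof -
  assume "k > 0"
  hence "inverse (1 - fps_X ^ k) = inverse (1 - fps_X :: real fps) oo fps_X ^ k"
    by (subst fps_inverse_compose) (auto simp: fps_compose_sub_distrib)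
  thus ?thesis
    by (simp add: nonneg_fps_def inverse_one_minus_X fps_nth_compose_X_power)
qed

lemma nonneg_inverse_eprod: "nonneg_fps (inverse (eprod S))"
proof (rule nonneg_fps_limit)
  show "(\<lambda>m. inverse (\<Prod>k\<in>S \<inter> {1..m}. 1 - fps_X ^ k)) \<longlonglongrightarrow> inverse (eprod S :: real fps)"
    by (intro tendsto_inverse_fps eprod_limit) simp
  show "nonneg_fps (inverse (\<Prod>k\<in>S \<inter> {1..m}. 1 - fps_X ^ k))" for m
    unfolding inverse_prod_fps by (intro nonneg_fps_prod nonneg_inverse_one_minus_X_power) auto
qed

text \<open>The factor 1/(1 - q) has all coefficients 1; the remaining factors have nonnegative
  coefficients and constant term 1.\<close>

lemma pos_inverse_eprod:
  assumes "1 \<in> S"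
  shows "pos_fps (inverse (eprod S))"
proof -
  have "inverse (eprod S :: real fps) = inverse (1 - fps_X) * inverse (eprod (S - {1}))"
    by (subst eprod_remove[OF assms]) (simp_all add: fps_inverse_mult)
  moreover have "pos_fps \<dots>"
    by (intro pos_fps_mult nonneg_inverse_eprod) (simp_all add: pos_fps_def inverse_one_minus_X)
  ultimately show ?thesis by simp
qed

text \<open>Over the common denominator the numerator is q^a - q^(a+1), so 1 - q splits off.\<close>

lemma lam_diff:
  assumes "a > 0"
  shows "lam a - lam (Suc a)
    = (1 - fps_X) * (fps_X ^ a * (inverse (1 - fps_X ^ a) * inverse (1 - fps_X ^ Suc a)) :: 'a::field fps)"
proof -
  define x where "x = (fps_X ^ a :: 'a fps)"
  define u v where "u = 1 - x" and "v = 1 - fps_X * x"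
  have u: "u * inverse u = 1" and v: "v * inverse v = 1"
    using assms by (auto intro!: inverse_mult_eq_1' simp: u_def v_def x_def)
  have "lam a - lam (Suc a) = x * inverse u * (v * inverse v) - fps_X * x * inverse v * (u * inverse u)"
    unfolding u v by (simp add: lam_def u_def v_def x_def mult_ac)
  also have "\<dots> = x * (v - fps_X * u) * (inverse u * inverse v)"
    by (simp add: algebra_simps)
  also have "v - fps_X * u = 1 - fps_X"
    by (simp add: u_def v_def algebra_simps)
  finally show ?thesis by (simp add: u_def v_def x_def mult_ac)
qed

lemma inverse_euler: "inverse euler_fps * euler_fps = (1 :: real fps)" "euler_fps * inverse euler_fps = (1 :: real fps)"
  by (auto intro: inverse_mult_eq_1 inverse_mult_eq_1')

text \<open>A difference \<open>lam a - lam (a + 1)\<close> may have negative coefficients; dividing by the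
  factor \<open>1 - q\<close> of the Euler product makes them nonnegative.\<close>

lemma nonneg_lambert3: "nonneg_fps ((1 + 6 * lambert3) * inverse euler_fps)"
proof (rule nonneg_fps_limit)
  define I where "I = (inverse euler_fps :: real fps)"
  have I: "(1 - fps_X) * I = inverse (eprod (UNIV - {1}))"
  proof -
    have "I = inverse (1 - fps_X) * inverse (eprod (UNIV - {1}))"
      unfolding I_def by (subst eprod_remove[of 1]) (simp_all add: fps_inverse_mult)
    thus ?thesis
      by (simp add: inverse_mult_eq_1' flip: mult.assoc)
  qed
  have "nonneg_fps ((lam (3 * i + 1) - lam (3 * i + 2)) * I)" for i
  proof -
    define Y where "Y = fps_X ^ (3 * i + 1) * (inverse (1 - fps_X ^ (3 * i + 1)) * inverse (1 - fps_X ^ Suc (3 * i + 1)) :: real fps)"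
    have "lam (3 * i + 1) - lam (3 * i + 2) = (1 - fps_X) * Y"
      unfolding Y_def by (subst lam_diff[symmetric]) simp_all
    hence "(lam (3 * i + 1) - lam (3 * i + 2)) * I = Y * ((1 - fps_X) * I)"
      by (simp only: mult_ac)
    moreover have "nonneg_fps Y"
      unfolding Y_def by (intro nonneg_fps_mult nonneg_fps_X_power nonneg_inverse_one_minus_X_power) auto
    ultimately show ?thesis
      unfolding I by (simp only: nonneg_fps_mult nonneg_inverse_eprod)
  qed
  moreover have "nonneg_fps I"
    unfolding I_def by (rule nonneg_inverse_eprod)
  ultimately have "nonneg_fps (I + 6 * (\<Sum>i<m. (lam (3 * i + 1) - lam (3 * i + 2)) * I))" for m
    by (intro nonneg_fps_add nonneg_fps_mult[OF nonneg_fps_numeral] nonneg_fps_sum)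
  thus "nonneg_fps ((1 + 6 * (\<Sum>i<m. lam (3 * i + 1) - lam (3 * i + 2))) * inverse euler_fps)" for m
    unfolding I_def by (simp only: distrib_right mult_1_left mult.assoc sum_distrib_right)
  show "(\<lambda>m. (1 + 6 * (\<Sum>i<m. lam (3 * i + 1) - lam (3 * i + 2))) * inverse euler_fps)
      \<longlonglongrightarrow> (1 + 6 * lambert3) * (inverse euler_fps :: real fps)"
    by (intro tendsto_fps_mult tendsto_fps_add tendsto_const lambert3_limit)
qed

section \<open>The quotients \<open>alpha\<close> and \<open>beta\<close> and the sign
  pattern\<close>

definition alpha :: "real fps" where
  "alpha = pent_fps * inverse euler_fps ^ 3"

definition beta :: "real fps" where
  "beta = (dil3 euler_fps * inverse euler_fps) ^ 3"

text \<open>The factor E of P cancels one of the three denominators. Of the other two, one makes the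
  Lambert factor nonnegative and the other makes the product strictly positive.\<close>

lemma pos_alpha: "pos_fps alpha"
proof -
  have "alpha = inverse euler_fps * ((1 + 6 * lambert3) * inverse euler_fps) * (euler_fps * inverse euler_fps)"
    unfolding alpha_def pent_fps_eq power3_eq_cube by (simp only: mult_ac)
  also have "\<dots> = inverse euler_fps * ((1 + 6 * lambert3) * inverse euler_fps)"
    unfolding inverse_euler by simp
  finally have *: "alpha = inverse euler_fps * ((1 + 6 * lambert3) * inverse euler_fps)" .
  show ?thesis
    unfolding * by (intro pos_fps_mult pos_inverse_eprod nonneg_lambert3) (simp_all add: lambert3_def)
qed

text \<open>By \<open>euler_fps_split\<close>, E_3/E is the inverse of \<open>eprod non3\<close>,
  and 1 lies in \<open>non3\<close>.\<close>

lemma pos_beta: "pos_fps beta"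
proof -
  define D where "D = (eprod non3 :: real fps)"
  have "inverse D = inverse D * (euler_fps * inverse euler_fps)"
    unfolding inverse_euler by simp
  also have "\<dots> = (inverse D * D) * (dil3 euler_fps * inverse euler_fps)"
    by (subst euler_fps_split) (simp only: D_def mult_ac)
  also have "inverse D * D = 1"
    by (auto intro: inverse_mult_eq_1 simp: D_def)
  finally have *: "dil3 euler_fps * inverse euler_fps = inverse D" by simp
  show ?thesis
    unfolding beta_def * D_def power3_eq_cube by (intro pos_fps_mult' pos_inverse_eprod) auto
qed

lemma trisection_nth:
  "(dil3 a + fps_X * dil3 b + fps_X ^ 2 * dil3 c) $ n =
     (if n mod 3 = 0 then a $ (n div 3) else if n mod 3 = 1 then b $ (n div 3) else c $ (n div 3))"
  for a :: "'a::comm_ring_1 fps"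
proof -
  have "n = 3 * (n div 3) + n mod 3" by simp
  moreover have "n mod 3 = 0 \<or> n mod 3 = 1 \<or> n mod 3 = 2" by presburger
  ultimately obtain k where "n = 3 * k \<or> n = 3 * k + 1 \<or> n = 3 * k + 2"
    by (metis add.right_neutral)
  moreover have "\<not> 3 dvd 3 * k + 1" "\<not> 3 dvd 3 * k + 2" for k :: nat by presburger+
  moreover have "(3 * k + 1) div 3 = k" "(3 * k + 2) div 3 = k" "(3 * k + 1) mod 3 = 1" "(3 * k + 2) mod 3 = 2"
    for k :: nat by presburger+
  moreover have "\<not> 3 dvd 3 * k - 1" "\<not> 3 dvd 3 * k - 2" if "k > 0" for k :: nat using that by presburger+
  ultimately show ?thesis
    by (auto simp: dil3_nth fps_X_power_mult_nth)
qed

text \<open>With F = E^3/E_3^3 one has A = F^3, and the part of A at exponents divisible by 3 is F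
  at q^3. So residues 0, 3, 6 modulo 9 inherit the signs of F at residues 0, 1, 2 modulo 3.\<close>

lemma sign_pattern:
  fixes A :: "real fps"
  assumes A: "A * dil3 euler_fps ^ 9 = euler_fps ^ 9"
  shows "n mod 9 \<in> {0, 2, 5, 8} \<Longrightarrow> A $ n > 0" "n mod 9 \<in> {1, 3, 4, 7} \<Longrightarrow> A $ n < 0"
    "n mod 9 = 6 \<Longrightarrow> A $ n = 0"
proof -
  define E where "E = (euler_fps :: real fps)"
  define F where "F = dil3 alpha - 3 * fps_X * dil3 beta"
  have E [simp]: "E \<noteq> 0" "dil3 E \<noteq> 0"
    using dil3_inj[of E 0] by (auto simp: E_def dil3_def)
  have inv: "inverse E * E = 1"
    unfolding E_def by (rule inverse_euler)
  have aE: "alpha * E ^ 3 = pent_fps"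
  proof -
    have "alpha * E ^ 3 = pent_fps * (inverse E * E) ^ 3"
      by (simp add: alpha_def E_def power_mult_distrib mult_ac)
    thus ?thesis by (simp add: inv)
  qed
  have bE: "beta * E ^ 3 = dil3 E ^ 3"
  proof -
    have "beta * E ^ 3 = dil3 E ^ 3 * (inverse E * E) ^ 3"
      by (simp add: beta_def E_def power_mult_distrib mult_ac)
    thus ?thesis by (simp add: inv)
  qed
  have FE: "F * dil3 E ^ 3 = E ^ 3"
  proof -
    have "F * dil3 E ^ 3 = dil3 (alpha * E ^ 3) - 3 * fps_X * dil3 (beta * E ^ 3)"
      by (simp add: F_def algebra_simps)
    also have "\<dots> = E ^ 3"
      unfolding aE bE unfolding E_def by (rule euler_cube_trisection[symmetric])
    finally show ?thesis .
  qed
  have "A * dil3 E ^ 9 = (F * dil3 E ^ 3) ^ 3"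
    unfolding FE using A by (simp add: E_def flip: power_mult)
  also have "\<dots> = F ^ 3 * dil3 E ^ 9"
    by (simp add: power_mult_distrib flip: power_mult)
  finally have A3: "A = F ^ 3" by simp
  \<comment> \<open>Multiplied by E_3^3 E^9, both sides become E^12: the left by
    \<open>cubic_norm\<close>, the right by \<open>FE\<close>.\<close>
  have gF: "alpha ^ 3 - 27 * fps_X * beta ^ 3 = F"
  proof -
    have "(alpha ^ 3 - 27 * fps_X * beta ^ 3) * dil3 E ^ 3 * E ^ 9
        = ((alpha * E ^ 3) ^ 3 - 27 * fps_X * (beta * E ^ 3) ^ 3) * dil3 E ^ 3"
      by (simp add: power_mult_distrib algebra_simps flip: power_mult)
    also have "\<dots> = E ^ 12"
      unfolding aE bE using cubic_norm by (simp add: E_def flip: power_mult)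
    also have "\<dots> = F * dil3 E ^ 3 * E ^ 9"
      unfolding FE by (simp flip: power_add)
    finally show ?thesis by simp
  qed
  have F: "F = dil3 alpha + fps_X * dil3 (- 3 * beta) + fps_X ^ 2 * dil3 0"
    by (simp add: F_def dil3_uminus) (simp add: dil3_def)
  have "A = dil3 (alpha ^ 3 - 27 * fps_X * beta ^ 3) - 9 * fps_X * dil3 (alpha ^ 2 * beta)
      + 27 * fps_X ^ 2 * dil3 (alpha * beta ^ 2)"
    unfolding A3 F_def by (simp add: algebra_simps power2_eq_square power3_eq_cube)
  also have "\<dots> = dil3 F + fps_X * dil3 (- 9 * (alpha ^ 2 * beta)) + fps_X ^ 2 * dil3 (27 * (alpha * beta ^ 2))"
    unfolding gF by (simp add: dil3_uminus)
  finally have An: "A $ n = (if n mod 3 = 0 then F $ (n div 3)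
      else if n mod 3 = 1 then (- 9 * (alpha ^ 2 * beta)) $ (n div 3) else (27 * (alpha * beta ^ 2)) $ (n div 3))"
    by (simp only: trisection_nth)
  have Fn: "F $ k = (if k mod 3 = 0 then alpha $ (k div 3) else if k mod 3 = 1 then (- 3 * beta) $ (k div 3) else 0)" for k
    by (subst F, subst trisection_nth) simp
  have pos: "pos_fps (alpha ^ 2 * beta)" "pos_fps (alpha * beta ^ 2)"
    unfolding power2_eq_square by (intro pos_fps_mult' pos_alpha pos_beta)+
  have num: "(numeral k * G) $ i = numeral k * G $ i" for k i and G :: "real fps"
    by (simp add: numeral_fps_const)
  show "A $ n > 0" if "n mod 9 \<in> {0, 2, 5, 8}"
  proof -
    \<comment> \<open>Residue 0 leads to a coefficient of \<open>alpha\<close>; residues 2, 5, 8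
      lead to one of \<open>27 * (alpha * beta ^ 2)\<close>.\<close>
    have "(n mod 3 = 0 \<and> n div 3 mod 3 = 0) \<or> n mod 3 = 2"
      using that unfolding insert_iff empty_iff by presburger
    thus ?thesis
      using pos pos_alpha unfolding An Fn pos_fps_def by (auto simp: num)
  qed
  show "A $ n < 0" if "n mod 9 \<in> {1, 3, 4, 7}"
  proof -
    have "(n mod 3 = 0 \<and> n div 3 mod 3 = 1) \<or> n mod 3 = 1"
      using that unfolding insert_iff empty_iff by presburger
    thus ?thesis
      using pos pos_beta unfolding An Fn pos_fps_def by (auto simp: num)
  qed
  show "A $ n = 0" if "n mod 9 = 6"
  proof -
    \<comment> \<open>This is the class of exponents that is absent from F.\<close>
    have "n mod 3 = 0 \<and> n div 3 mod 3 = 2"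
      using that by presburger
    thus ?thesis
      unfolding An Fn by simp
  qed
qed

section \<open>The analytic product\<close>

text \<open>The Weierstrass M-test with a geometric majorant. Only the germ at 0 matters later, so
  the disc of radius 1/2 suffices.\<close>

lemma qpoch_uniform_limit:
  "uniform_limit (cball 0 (1/2)) (\<lambda>N q. \<Prod>k<N. 1 - q * q ^ k) (\<lambda>q. qpoch_inf q q) sequentially"
proof -
  have bound: "norm (1 - q * q ^ k - 1) \<le> (1/2) ^ Suc k" if "q \<in> cball 0 (1/2)" for q :: complex and k
    using power_mono[of "norm q" "1/2" "Suc k"] that by (simp add: norm_mult norm_power)
  have summ: "summable (\<lambda>k. (1/2 :: real) ^ Suc k)"
    by (simp add: summable_geometric del: power_Suc add: summable_Suc_iff[where f = "\<lambda>k. (1/2) ^ k"])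
  have "uniformly_convergent_on (cball 0 (1/2)) (\<lambda>N q :: complex. \<Prod>k<N. 1 - q * q ^ k)"
  proof (rule uniformly_convergent_on_prod')
    show "uniformly_convergent_on (cball 0 (1/2)) (\<lambda>N q :: complex. \<Sum>k<N. norm (1 - q * q ^ k - 1))"
      by (rule Weierstrass_m_test'[OF _ summ]) (use bound in auto)
  qed (auto intro!: continuous_intros)
  then obtain l where l: "uniform_limit (cball 0 (1/2)) (\<lambda>N q :: complex. \<Prod>k<N. 1 - q * q ^ k) l sequentially"
    by (auto simp: uniformly_convergent_on_def)
  have "l q = qpoch_inf q q" if q: "q \<in> cball 0 (1/2)" for q
  proof -
    have "summable (\<lambda>k. norm (1 - q * q ^ k - 1))"
      by (rule summable_comparison_test[OF _ summ]) (use bound[OF q] in auto)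
    hence "convergent_prod (\<lambda>k. 1 - q * q ^ k)"
      by (intro abs_convergent_prod_imp_convergent_prod summable_imp_abs_convergent_prod)
    hence "(\<lambda>n. \<Prod>k\<le>n. 1 - q * q ^ k) \<longlonglongrightarrow> qpoch_inf q q"
      unfolding qpoch_inf_def by (rule convergent_prod_LIMSEQ)
    hence "(\<lambda>n. \<Prod>k<n. 1 - q * q ^ k) \<longlonglongrightarrow> qpoch_inf q q"
      by (simp add: LIMSEQ_lessThan_iff_atMost)
    thus ?thesis
      using tendsto_uniform_limitI[OF l q] LIMSEQ_unique by blast
  qed
  thus ?thesis
    using l uniform_limit_cong'[of "cball 0 (1/2)"] by (metis (no_types, lifting))
qed

text \<open>Under uniform convergence of holomorphic functions the Taylor coefficients at 0
  converge, while by \<open>eprod_nth\<close> those of the partial products are eventually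
  constant.\<close>

lemma qpoch_has_fps_expansion: "(\<lambda>q. qpoch_inf q q) has_fps_expansion euler_fps"
proof -
  define f where "f = (\<lambda>N (q :: complex). \<Prod>k<N. 1 - q * q ^ k)"
  define g where "g = (\<lambda>q. qpoch_inf q q)"
  have ul: "uniform_limit (cball 0 (1/2)) f g sequentially"
    unfolding f_def g_def by (rule qpoch_uniform_limit)
  have holo: "f N holomorphic_on A" for N A
    unfolding f_def by (intro holomorphic_intros)
  have "g holomorphic_on ball 0 (1/2)"
    by (rule holomorphic_uniform_limit[OF _ ul]) (intro always_eventually allI conjI holo holomorphic_on_imp_continuous_on, simp)
  hence g: "g has_fps_expansion fps_expansion g 0"
    by (intro has_fps_expansion_fps_expansion[of "ball 0 (1/2)"]) auto
  have "fps_expansion g 0 $ n = euler_fps $ n" for n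
  proof -
    have "(\<lambda>N. (deriv ^^ n) (f N) 0) \<longlonglongrightarrow> (deriv ^^ n) g 0"
    proof (rule higher_deriv_complex_uniform_limit)
      show "uniform_limit (ball 0 (1/2)) f g sequentially"
        by (rule uniform_limit_on_subset[OF ul]) auto
    qed (auto simp: holo)
    hence "(\<lambda>N. (deriv ^^ n) (f N) 0 / fact n) \<longlonglongrightarrow> fps_expansion g 0 $ n"
      unfolding fps_nth_fps_expansion[OF g] by (intro tendsto_divide tendsto_const) auto
    moreover have "eventually (\<lambda>N. (deriv ^^ n) (f N) 0 / fact n = euler_fps $ n) sequentially"
      using eventually_ge_at_top[of n]
    proof eventually_elim
      case (elim N)
      have "f N has_fps_expansion (\<Prod>k<N. 1 - fps_X * fps_X ^ k)"
        unfolding f_def by (intro fps_expansion_intros)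
      also have "(\<Prod>k<N. 1 - fps_X * fps_X ^ k) = (\<Prod>k\<in>UNIV \<inter> {1..N}. 1 - fps_X ^ k :: complex fps)"
        by (simp add: prod.atLeast1_atMost_eq)
      finally have "(deriv ^^ n) (f N) 0 / fact n = (\<Prod>k\<in>UNIV \<inter> {1..N}. 1 - fps_X ^ k :: complex fps) $ n"
        by (rule fps_nth_fps_expansion[symmetric])
      thus ?case by (simp only: eprod_nth[OF elim])
    qed
    ultimately have "(\<lambda>_ :: nat. euler_fps $ n) \<longlonglongrightarrow> fps_expansion g 0 $ n"
      by (rule Lim_transform_eventually)
    thus ?thesis
      using LIMSEQ_unique[OF _ tendsto_const] by blast
  qed
  hence "fps_expansion g 0 = euler_fps"
    by (rule fps_ext)
  thus ?thesis using g by (simp add: g_def)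
qed

section \<open>From the analytic expansion to the formal identity\<close>

theorem theorem1p3:
  fixes a :: "nat \<Rightarrow> real"
  assumes expansion: "\<forall>q::complex. norm q < 1 \<longrightarrow>
     (\<lambda>n. complex_of_real (a n) * q ^ n) sums
       (qpoch_inf q q ^ 9 / qpoch_inf (q ^ 3) (q ^ 3) ^ 9)"
  shows "\<forall>n. (n mod 9 \<in> {0, 2, 5, 8} \<longrightarrow> a n > 0)
            \<and> (n mod 9 \<in> {1, 3, 4, 7} \<longrightarrow> a n < 0)
            \<and> (n mod 9 = 6 \<longrightarrow> a n = 0)"
proof -
  define A where "A = Abs_fps a"
  define E where "E = (euler_fps :: complex fps)"
  have sums: "(\<lambda>n. cplx A $ n * q ^ n) sums (qpoch_inf q q ^ 9 / qpoch_inf (q ^ 3) (q ^ 3) ^ 9)"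
    if "norm q < 1" for q
    using expansion that by (simp add: A_def)
  \<comment> \<open>Convergence at 1/2 makes the radius of convergence positive, so \<open>A\<close>
    is the Taylor series of the quotient at 0.\<close>
  have "norm (1/2 :: complex) \<le> conv_radius (fps_nth (cplx A))"
    by (rule conv_radius_geI) (use sums[of "1/2"] in \<open>auto simp: sums_iff\<close>)
  hence "fps_conv_radius (cplx A) > 0"
    unfolding fps_conv_radius_def by (rule less_le_trans[rotated]) simp
  hence "eval_fps (cplx A) has_fps_expansion cplx A"
    by (rule eval_fps_has_fps_expansion)
  also have "eventually (\<lambda>q. eval_fps (cplx A) q = qpoch_inf q q ^ 9 / qpoch_inf (q ^ 3) (q ^ 3) ^ 9) (nhds 0)"
  proof (rule eventually_mono[OF eventually_nhds_in_open[of "ball 0 1"]])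
    fix q :: complex assume "q \<in> ball 0 1"
    thus "eval_fps (cplx A) q = qpoch_inf q q ^ 9 / qpoch_inf (q ^ 3) (q ^ 3) ^ 9"
      using sums[of q] by (simp add: eval_fps_def sums_iff)
  qed auto
  hence "eval_fps (cplx A) has_fps_expansion cplx A \<longleftrightarrow>
      (\<lambda>q. qpoch_inf q q ^ 9 / qpoch_inf (q ^ 3) (q ^ 3) ^ 9) has_fps_expansion cplx A"
    by (intro has_fps_expansion_cong refl)
  finally have exp1: "(\<lambda>q. qpoch_inf q q ^ 9 / qpoch_inf (q ^ 3) (q ^ 3) ^ 9) has_fps_expansion cplx A" .
  have "((\<lambda>q. qpoch_inf q q) \<circ> (\<lambda>q. q ^ 3)) has_fps_expansion dil3 E"
    unfolding dil3_def E_def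
    by (intro has_fps_expansion_compose qpoch_has_fps_expansion has_fps_expansion_fps_X_power) simp
  hence E3: "(\<lambda>q. qpoch_inf (q ^ 3) (q ^ 3)) has_fps_expansion dil3 E"
    by (simp add: o_def)
  have "(\<lambda>q. qpoch_inf q q ^ 9 * inverse (qpoch_inf (q ^ 3) (q ^ 3) ^ 9)) has_fps_expansion
      E ^ 9 * inverse (dil3 E ^ 9)"
    unfolding E_def
    by (intro has_fps_expansion_mult has_fps_expansion_inverse has_fps_expansion_power
        qpoch_has_fps_expansion E3[unfolded E_def]) (simp add: dil3_nth fps_power_zeroth)
  \<comment> \<open>Expansions are unique, so the quotient becomes a formal one; once the
    denominator is cleared, the equation descends to real series.\<close>
  hence "cplx A = E ^ 9 * inverse (dil3 E ^ 9)"
    using exp1 fps_expansion_unique_complex by (simp add: field_class.field_divide_inverse)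
  moreover have "inverse (dil3 E ^ 9) * dil3 E ^ 9 = 1"
    by (intro inverse_mult_eq_1) (simp add: E_def dil3_nth fps_power_zeroth)
  ultimately have "cplx (A * dil3 euler_fps ^ 9) = cplx (euler_fps ^ 9)"
    by (simp add: cplx_dil3 cplx_eprod E_def mult.assoc)
  hence "A * dil3 euler_fps ^ 9 = euler_fps ^ 9"
    by (rule cplx_inj)
  from sign_pattern[OF this] show ?thesis
    by (simp add: A_def)
qed

end
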